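(* Assume that $A_0^i$ and $A_{22}^i$ are Hurwitz for all $i\in\mathcal I$, and let $\gamma_{11}>1$. Then there exist $\varepsilon_1^*>0$ and a function $\eta_1:(0,\varepsilon_1^* )\to[0,\infty)$ with $\eta_1(\varepsilon)=\mathcal O(\varepsilon)$ such that for all $\varepsilon\in(0,\varepsilon_1^* )$, for all sequences $(t_k)_{k\ge 0}$ of event times satisfying, for some $\tau^*$ with $$\tau^*>\frac{\ln(\gamma_{11})}{\lambda_s}+\eta_1(\varepsilon),$$ the dwell-time property $\tau_k:=t_{k+1}-t_k\ge\tau^*$ for all $k\in\mathbb N$, and for all sequences $(\sigma_k)_{k\ge0}$ in $\mathcal I$ and $(\nu_k)_{k\ge1}$ in $\mathcal J$, the singularly perturbed hybrid system (H) is globally asymptotically stable.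
   Context: Setting. Let $n_x,n_z\ge1$, $n=n_x+n_z$, let $\varepsilon>0$ be a parameter and $\mathcal I,\mathcal J$ finite nonempty index sets. For each $i\in\mathcal I$, $\mathbf D^i$ is an $n\times n$ diagonal matrix with $n_z$ diagonal entries equal to $\varepsilon$ and the other $n_x$ equal to $1$ (positions may depend on $i$), and $S_i$ is a permutation matrix with $S_i\mathbf D^iS_i^\top=\mathrm{diag}(I_{n_x},\varepsilon I_{n_z})$. Let $\mathbf A^i\in\mathbb R^{n\times n}$ ($i\in\mathcal I$) and $\mathbf J^j\in\mathbb R^{n\times n}$ ($j\in\mathcal J$) be given (independent of $\varepsilon$), and set $A^i=S_i\mathbf A^iS_i^\top$, $J^{i\stackrel{j}{\to}i'}=S_{i'}\mathbf J^jS_i^\top$ for $i,i'\in\mathcal I$, $j\in\mathcal J$. Write in blocks of sizes $n_x,n_z$: $$A^i=\begin{pmatrix} A^i_{11} & A^i_{12} \\ A^i_{21} & A^i_{22} \end{pmatrix},$$ with $A_{22}^i$ non-singular. Set $A_0^i=A_{11}^i-A_{12}^i(A_{22}^i)^{-1}A_{21}^i$, $B_1^i=A_{12}^i$, $B_2^i=(A_{22}^i)^{-1}A_{21}^iA_0^i$, $B_3^i=(A_{22}^i)^{-1}A_{21}^iA_{12}^i$, $$P_i=\begin{pmatrix} I_{n_x} & 0 \\ (A_{22}^i)^{-1}A_{21}^i & I_{n_z} \end{pmatrix},\qquad R^{i\stackrel{j}{\to}i'}=P_{i'}J^{i\stackrel{j}{\to}i'}P_i^{-1}=\begin{pmatrix}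 R_{11}^{i\stackrel{j}{\to}i'} & R_{12}^{i\stackrel{j}{\to}i'} \\ R_{21}^{i\stackrel{j}{\to}i'} & R_{22}^{i\stackrel{j}{\to}i'} \end{pmatrix}.$$ A sequence of event times is a strictly increasing unbounded sequence $0=t_0<t_1<\cdots$. Given such a sequence, modes $\sigma_k\in\mathcal I$ ($k\ge0$) and $\nu_k\in\mathcal J$ ($k\ge1$), system (H) with state $(x(t),y(t))\in\mathbb R^{n_x}\times\mathbb R^{n_z}$ is, for $t\in[t_k,t_{k+1})$, $k\in\mathbb N$, $$\dot x=A_0^{\sigma_k}x+B_1^{\sigma_k}y,\qquad \varepsilon\dot y=\varepsilon B_2^{\sigma_k}x+(A_{22}^{\sigma_k}+\varepsilon B_3^{\sigma_k})y,$$ and, for $k\ge1$, $\begin{pmatrix} x(t_k) \\ y(t_k) \end{pmatrix}=R^{\sigma_{k-1}\stackrel{\nu_k}{\to}\sigma_k}\begin{pmatrix} x(t_k^-) \\ y(t_k^-) \end{pmatrix}$, where $t_k^-$ denotes the left limit. Globally asymptotically stable means: the origin is Lyapunov stable (for every $\rho>0$ there is $\delta>0$ such that initial states at time $0$ of norm $<\delta$ give solutions of norm $<\rho$ for all $t\ge0$) and every solution tends to $0$ as $t\to\infty$. Constants. Since $A_0^i,A_{22}^i$ are Hurwitz, fix symmetric matrices $Q_s^i\ge I_{n_x}$, $Q_f^i\ge I_{n_z}$ and numbers $\lambda_s^i,\lambda_f^i>0$ with $A_0^{i\top}Q_s^i+Q_s^iA_0^i\le-2\lambda_s^iQ_s^i$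 and $A_{22}^{i\top}Q_f^i+Q_f^iA_{22}^i\le-2\lambda_f^iQ_f^i$ for all $i\in\mathcal I$. Put $\lambda_s=\min_i\lambda_s^i$, $\lambda_f=\min_i\lambda_f^i$ and, with $\|\cdot\|$ the spectral norm, $$\gamma_{11}=\max_{i,i'\in\mathcal I,\,j\in\mathcal J}\|(Q_s^{i'})^{1/2}R_{11}^{i\stackrel{j}{\to}i'}(Q_s^i)^{-1/2}\|.$$ $\eta(\varepsilon)=\mathcal O(\varepsilon)$ for a function $\eta$ on $(0,\varepsilon^* )$ means: there are $\varepsilon_0\in(0,\varepsilon^* )$ and $c>0$ with $|\eta(\varepsilon)|\le c\varepsilon$ for all $\varepsilon\in(0,\varepsilon_0)$. *)

theory Defs
  imports "HOL-Analysis.Analysis"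
begin

subsection \<open>Matrix notions\<close>

definition hurwitz :: "real^'n^'n \<Rightarrow> bool" where
  "hurwitz M \<longleftrightarrow>
     (\<forall>(l::complex) v. v \<noteq> 0 \<and> map_matrix complex_of_real M *v v = l *s v \<longrightarrow> Re l < 0)"

definition sym_matrix :: "real^'n^'n \<Rightarrow> bool" where
  "sym_matrix M \<longleftrightarrow> transpose M = M"

text \<open>The Loewner order; it is only used between symmetric matrices.\<close>

definition loewner_le :: "real^'n^'n \<Rightarrow> real^'n^'n \<Rightarrow> bool" where
  "loewner_le M N \<longleftrightarrow> (\<forall>v. v \<bullet> (M *v v) \<le> v \<bullet> (N *v v))"

text \<open>Meaningful for symmetric positive semidefinite arguments, for which the root exists
  and is unique.\<close>

definition psd_sqrt :: "real^'n^'n \<Rightarrow> real^'n^'n" where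
  "psd_sqrt Q = (THE X. sym_matrix X \<and> loewner_le 0 X \<and> X ** X = Q)"

definition spectral_norm :: "real^'n^'m \<Rightarrow> real" where
  "spectral_norm M = onorm ((*v) M)"

definition permutation_matrix :: "real^'n^'n \<Rightarrow> bool" where
  "permutation_matrix S \<longleftrightarrow> (\<exists>p. bij p \<and> S = (\<chi> a b. if b = p a then 1 else 0))"

subsection \<open>Block matrices\<close>

text \<open>The index type of the full state is the sum type \<open>'x + 'z\<close>, with \<open>CARD('x)\<close> slow and
  \<open>CARD('z)\<close> fast coordinates.\<close>

definition block11 :: "real^('x::finite + 'z::finite)^('x + 'z) \<Rightarrow> real^'x^'x" where
  "block11 M = (\<chi> a b. M $ Inl a $ Inl b)"

definition block12 :: "real^('x::finite + 'z::finite)^('x + 'z) \<Rightarrow> real^'z^'x" where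
  "block12 M = (\<chi> a b. M $ Inl a $ Inr b)"

definition block21 :: "real^('x::finite + 'z::finite)^('x + 'z) \<Rightarrow> real^'x^'z" where
  "block21 M = (\<chi> a b. M $ Inr a $ Inl b)"

definition block22 :: "real^('x::finite + 'z::finite)^('x + 'z) \<Rightarrow> real^'z^'z" where
  "block22 M = (\<chi> a b. M $ Inr a $ Inr b)"

definition block_matrix ::
  "real^'x^'x \<Rightarrow> real^'z^'x \<Rightarrow> real^'x^'z \<Rightarrow> real^'z^'z \<Rightarrow> real^('x::finite + 'z::finite)^('x + 'z)" where
  "block_matrix K L M N =
     (\<chi> a b. case a of
        Inl a' \<Rightarrow> (case b of Inl b' \<Rightarrow> K $ a' $ b' | Inr b' \<Rightarrow> L $ a' $ b')
      | Inr a' \<Rightarrow> (case b of Inl b' \<Rightarrow> M $ a' $ b' | Inr b' \<Rightarrow> N $ a' $ b'))"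

definition join_vec :: "real^'x \<Rightarrow> real^'z \<Rightarrow> real^('x::finite + 'z::finite)" where
  "join_vec x y = (\<chi> a. case a of Inl b \<Rightarrow> x $ b | Inr b \<Rightarrow> y $ b)"

subsection \<open>Data of the hybrid system\<close>

text \<open>The diagonal matrix with entry \<open>\<epsilon>\<close> at the positions in \<open>Z\<close> and \<open>1\<close> elsewhere.\<close>

definition scale_matrix :: "'n set \<Rightarrow> real \<Rightarrow> real^'n^'n" where
  "scale_matrix Z \<epsilon> = (\<chi> a b. if a = b then (if a \<in> Z then \<epsilon> else 1) else 0)"

definition flow_matrix ::
  "('i \<Rightarrow> real^'n^'n) \<Rightarrow> ('i \<Rightarrow> real^'n^'n) \<Rightarrow> 'i \<Rightarrow> real^'n^'n" where
  "flow_matrix S A i = S i ** A i ** transpose (S i)"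

definition jump_matrix ::
  "('i \<Rightarrow> real^'n^'n) \<Rightarrow> ('j \<Rightarrow> real^'n^'n) \<Rightarrow> 'i \<Rightarrow> 'j \<Rightarrow> 'i \<Rightarrow> real^'n^'n" where
  "jump_matrix S J i j i' = S i' ** J j ** transpose (S i)"

definition coef_A0 :: "real^('x::finite + 'z::finite)^('x + 'z) \<Rightarrow> real^'x^'x" where
  "coef_A0 M = block11 M - block12 M ** matrix_inv (block22 M) ** block21 M"

definition coef_B1 :: "real^('x::finite + 'z::finite)^('x + 'z) \<Rightarrow> real^'z^'x" where
  "coef_B1 M = block12 M"

definition coef_B2 :: "real^('x::finite + 'z::finite)^('x + 'z) \<Rightarrow> real^'x^'z" where
  "coef_B2 M = matrix_inv (block22 M) ** block21 M ** coef_A0 M"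

definition coef_B3 :: "real^('x::finite + 'z::finite)^('x + 'z) \<Rightarrow> real^'z^'z" where
  "coef_B3 M = matrix_inv (block22 M) ** block21 M ** block12 M"

definition change_matrix ::
  "real^('x::finite + 'z::finite)^('x + 'z) \<Rightarrow> real^('x + 'z)^('x + 'z)" where
  "change_matrix M =
     block_matrix (mat 1) 0 (matrix_inv (block22 M) ** block21 M) (mat 1)"

definition reset_matrix ::
  "('i \<Rightarrow> real^('x::finite + 'z::finite)^('x + 'z)) \<Rightarrow> ('i \<Rightarrow> real^('x + 'z)^('x + 'z))
     \<Rightarrow> ('j \<Rightarrow> real^('x + 'z)^('x + 'z)) \<Rightarrow> 'i \<Rightarrow> 'j \<Rightarrow> 'i \<Rightarrow> real^('x + 'z)^('x + 'z)" where
  "reset_matrix S A J i j i' =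
     change_matrix (flow_matrix S A i') ** jump_matrix S J i j i'
       ** matrix_inv (change_matrix (flow_matrix S A i))"

definition gamma11 ::
  "('i::finite \<Rightarrow> real^('x::finite + 'z::finite)^('x + 'z)) \<Rightarrow> ('i \<Rightarrow> real^('x + 'z)^('x + 'z))
     \<Rightarrow> ('j::finite \<Rightarrow> real^('x + 'z)^('x + 'z)) \<Rightarrow> ('i \<Rightarrow> real^'x^'x) \<Rightarrow> real" where
  "gamma11 S A J Qs =
     (MAX (i, j, i') \<in> UNIV. spectral_norm
        (psd_sqrt (Qs i') ** block11 (reset_matrix S A J i j i')
           ** matrix_inv (psd_sqrt (Qs i))))"

subsection \<open>Solutions and stability\<close>

definition event_times :: "(nat \<Rightarrow> real) \<Rightarrow> bool" where
  "event_times t \<longleftrightarrow> t 0 = 0 \<and> strict_mono t \<and> \<not> bdd_above (range t)"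

text \<open>The derivative within \<open>{t k..<t (k + 1)}\<close> is the right derivative at \<open>t k\<close> and the
  two-sided one at interior points. The values of \<open>\<phi>\<close> at negative times and \<open>\<nu> 0\<close>
  are irrelevant.\<close>

definition solution_H ::
  "('i \<Rightarrow> real^('x::finite + 'z::finite)^('x + 'z)) \<Rightarrow> ('i \<Rightarrow> real^('x + 'z)^('x + 'z))
     \<Rightarrow> ('j \<Rightarrow> real^('x + 'z)^('x + 'z)) \<Rightarrow> real \<Rightarrow> (nat \<Rightarrow> real) \<Rightarrow> (nat \<Rightarrow> 'i) \<Rightarrow> (nat \<Rightarrow> 'j)
     \<Rightarrow> (real \<Rightarrow> (real^'x) \<times> (real^'z)) \<Rightarrow> bool" where
  "solution_H S A J \<epsilon> t \<sigma> \<nu> \<phi> \<longleftrightarrow>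
     (\<forall>k. \<forall>s\<in>{t k..<t (Suc k)}. \<exists>x' y'.
        ((\<lambda>r. fst (\<phi> r)) has_vector_derivative x') (at s within {t k..<t (Suc k)}) \<and>
        ((\<lambda>r. snd (\<phi> r)) has_vector_derivative y') (at s within {t k..<t (Suc k)}) \<and>
        (let M = flow_matrix S A (\<sigma> k) in
           x' = coef_A0 M *v fst (\<phi> s) + coef_B1 M *v snd (\<phi> s) \<and>
           \<epsilon> *\<^sub>R y' = (\<epsilon> *\<^sub>R coef_B2 M) *v fst (\<phi> s)
                     + (block22 M + \<epsilon> *\<^sub>R coef_B3 M) *v snd (\<phi> s))) \<and>
     (\<forall>k\<ge>1. \<exists>xm ym. (\<phi> \<longlongrightarrow> (xm, ym)) (at_left (t k)) \<and>
        join_vec (fst (\<phi> (t k))) (snd (\<phi> (t k)))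
          = reset_matrix S A J (\<sigma> (k - 1)) (\<nu> k) (\<sigma> k) *v join_vec xm ym)"

definition globally_asymptotically_stable ::
  "((real \<Rightarrow> 'a::real_normed_vector) \<Rightarrow> bool) \<Rightarrow> bool" where
  "globally_asymptotically_stable sol \<longleftrightarrow>
     (\<forall>\<rho>>0. \<exists>\<delta>>0. \<forall>\<phi>. sol \<phi> \<and> norm (\<phi> 0) < \<delta> \<longrightarrow> (\<forall>t\<ge>0. norm (\<phi> t) < \<rho>)) \<and>
     (\<forall>\<phi>. sol \<phi> \<longrightarrow> (\<phi> \<longlongrightarrow> 0) at_top)"

definition order_eps :: "real \<Rightarrow> (real \<Rightarrow> real) \<Rightarrow> bool" where
  "order_eps \<epsilon>s \<eta> \<longleftrightarrow>
     (\<exists>\<epsilon>0\<in>{0<..<\<epsilon>s}. \<exists>c>0. \<forall>\<epsilon>\<in>{0<..<\<epsilon>0}. \<bar>\<eta> \<epsilon>\<bar> \<le> c * \<epsilon>)"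

end

theory Submission
  imports Defs
begin

text \<open>Let \<open>w\<^sub>s\<close> and \<open>w\<^sub>f\<close> be the norms of \<open>x\<close> and \<open>y\<close> weighted by \<open>Q\<^sub>s\<^sup>1\<^sup>/\<^sup>2\<close> and \<open>Q\<^sub>f\<^sup>1\<^sup>/\<^sup>2\<close>, and let
  \<open>\<beta>\<close> bound all coupling coefficients. Along the flow \<open>w\<^sub>s' \<le> - \<lambda>\<^sub>s w\<^sub>s + \<beta> w\<^sub>f\<close> and
  \<open>w\<^sub>f' \<le> \<beta> w\<^sub>s - \<mu> w\<^sub>f\<close> with \<open>\<mu> = \<lambda>\<^sub>f / \<epsilon> - \<beta>\<close>. For \<open>\<kappa> = 2 \<beta> \<epsilon> / \<lambda>\<^sub>f\<close> the function
  \<open>V = w\<^sub>s + \<kappa> w\<^sub>f\<close> decays at the rate \<open>\<alpha> = \<lambda>\<^sub>s - \<kappa> \<beta> = \<lambda>\<^sub>s - O(\<epsilon>)\<close>, and \<open>w\<^sub>f\<close> becomes \<open>O(\<epsilon>) V\<close> by the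
  end of a period of length \<open>\<tau> \<ge> ln \<gamma>\<^sub>1\<^sub>1 / \<lambda>\<^sub>s > 0\<close>, because the initial fast part is damped by
  \<open>exp (- \<mu> \<tau>) \<le> exp (- \<alpha> \<tau>) O(\<epsilon>)\<close>. Hence \<open>L = w\<^sub>s + p \<epsilon> w\<^sub>f\<close>, with \<open>p\<close> large enough, is multiplied
  over a period and the following jump by at most \<open>exp (- \<alpha> \<tau>) (\<gamma>\<^sub>1\<^sub>1 + O(\<epsilon>))\<close>, which is below \<open>1\<close> as soon as
  \<open>\<tau> > ln \<gamma>\<^sub>1\<^sub>1 / \<lambda>\<^sub>s + O(\<epsilon>)\<close>.\<close>

subsection \<open>The positive semidefinite square root\<close>

lemma dot_sym_matrix: "sym_matrix X \<Longrightarrow> (X *v v) \<bullet> w = v \<bullet> (X *v w)"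
  by (metis dot_lmul_matrix sym_matrix_def transpose_matrix_vector)

text \<open>Scaling \<open>T\<close> to \<open>T / K\<^sup>2 = 1 - H\<close> with \<open>norm H < 1\<close>, the root is \<open>K (1 - Y)\<close>, where \<open>Y\<close> is the fixed
  point of the contraction \<open>Y \<mapsto> (H + Y\<^sup>2) / 2\<close>.\<close>

lemma self_adjoint_sqrt_exists:
  fixes T :: "'a::euclidean_space \<Rightarrow>\<^sub>L 'a"
  assumes sym: "\<And>v w. T v \<bullet> w = v \<bullet> T w" and ge: "\<And>v. v \<bullet> v \<le> v \<bullet> T v"
  shows "\<exists>X. (\<forall>v w. blinfun_apply X v \<bullet> w = v \<bullet> X w) \<and> (\<forall>v. 0 \<le> v \<bullet> X v) \<and> X o\<^sub>L X = T"
proof -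
  define K where "K = norm T + 1"
  have K: "K \<ge> 1" "K > 0" by (auto simp: K_def add_nonneg_pos)
  have TK: "norm (T v) \<le> K * norm v" for v
    using norm_blinfun[of T v] norm_ge_zero[of v] by (simp add: K_def distrib_right del: norm_ge_zero)
  define r where "r = sqrt (1 - 1 / K\<^sup>2)"
  define H where "H = id_blinfun - (1 / K\<^sup>2) *\<^sub>R T"
  have rK: "1 / K\<^sup>2 \<le> 1" "1 / K\<^sup>2 > 0" using K by (auto simp: field_simps)
  have r: "0 \<le> r" "r < 1" "r\<^sup>2 = 1 - 1 / K\<^sup>2"
    using rK by (auto simp: r_def)
  \<comment> \<open>Expanding the square, \<open>v \<bullet> v \<le> v \<bullet> T v\<close> bounds
    the cross term and \<open>norm (T v) \<le> K * norm v\<close> the last one. The factor is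
    \<open>1 - 2 / K\<^sup>2 + 1 / K\<^sup>2\<close>, which is \<open>r\<^sup>2\<close>.\<close>
  have Hv: "norm (H v) \<le> r * norm v" for v
  proof -
    have "(norm (H v))\<^sup>2 = v \<bullet> v - 2 * (1 / K\<^sup>2) * (v \<bullet> T v) + (1 / K\<^sup>2)\<^sup>2 * (norm (T v))\<^sup>2"
      unfolding power2_norm_eq_inner
      by (simp add: H_def blinfun.diff_left blinfun.scaleR_left inner_simps power2_eq_square
          inner_commute algebra_simps)
    also have "\<dots> \<le> v \<bullet> v - 2 * (1 / K\<^sup>2) * (v \<bullet> v) + (1 / K\<^sup>2)\<^sup>2 * (K * norm v)\<^sup>2"
      using ge[of v] TK[of v] rK
      by (intro add_mono diff_mono mult_left_mono power_mono) auto
    also have "\<dots> = (r * norm v)\<^sup>2"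
    proof -
      have "(1 / K\<^sup>2)\<^sup>2 * K\<^sup>2 = 1 / K\<^sup>2" using K by (simp add: field_simps power2_eq_square)
      thus ?thesis
        unfolding power_mult_distrib r(3) power2_norm_eq_inner mult.assoc[symmetric]
        by (simp only:) (simp add: algebra_simps)
    qed
    finally show ?thesis using r(1) by (simp add: power2_le_iff_abs_le)
  qed
  have nH: "norm H \<le> r"
    using Hv r(1) by (intro norm_blinfun_bound) auto
  have symH: "H v \<bullet> w = v \<bullet> H w" for v w
    by (simp add: H_def blinfun.diff_left blinfun.scaleR_left inner_simps sym)
  \<comment> \<open>Self-adjointness is built into the complete set, so the fixed point inherits it.
    The radius \<open>r\<close> is preserved because \<open>(r + r * r) / 2 \<le> r\<close>.\<close>
  define S where "S = {Y :: 'a \<Rightarrow>\<^sub>L 'a. norm Y \<le> r \<and> (\<forall>v w. blinfun_apply Y v \<bullet> w = v \<bullet> blinfun_apply Y w)}"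
  define f where "f Y = (1/2) *\<^sub>R (H + (Y o\<^sub>L Y))" for Y :: "'a \<Rightarrow>\<^sub>L 'a"
  have "closed S"
    unfolding S_def
    by (intro closed_Collect_conj closed_Collect_all closed_Collect_le closed_Collect_eq continuous_intros)
  hence "complete S" by (simp add: complete_eq_closed)
  moreover have "S \<noteq> {}" using nH symH by (auto simp: S_def)
  moreover have "f ` S \<subseteq> S"
  proof safe
    fix Y assume Y: "Y \<in> S"
    have "norm (Y o\<^sub>L Y) \<le> r * r"
      using Y r(1) by (intro order_trans[OF norm_blinfun_compose] mult_mono) (auto simp: S_def)
    also have "\<dots> \<le> r" using r by (simp add: mult_left_le)
    finally have "norm (f Y) \<le> r"
      using norm_triangle_ineq[of H "Y o\<^sub>L Y"] nH by (simp add: f_def)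
    thus "f Y \<in> S"
      using Y symH by (auto simp: S_def f_def blinfun.add_left blinfun.scaleR_left inner_simps)
  qed
  moreover have "dist (f Y) (f Z) \<le> r * dist Y Z" if "Y \<in> S" "Z \<in> S" for Y Z
  proof -
    have "f Y - f Z = (1/2) *\<^sub>R ((Y o\<^sub>L (Y - Z)) + ((Y - Z) o\<^sub>L Z))"
      by (rule blinfun_eqI) (simp add: f_def blinfun.bilinear_simps algebra_simps)
    also have "norm \<dots> \<le> (1/2) * (norm (Y o\<^sub>L (Y - Z)) + norm ((Y - Z) o\<^sub>L Z))"
      using norm_triangle_ineq[of "Y o\<^sub>L (Y - Z)"] by simp
    also have "\<dots> \<le> (1/2) * (r * norm (Y - Z) + norm (Y - Z) * r)"
      using that unfolding S_def
      by (intro mult_left_mono add_mono order_trans[OF norm_blinfun_compose] mult_right_mono) auto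
    finally show ?thesis by (simp add: dist_norm)
  qed
  ultimately have "\<exists>!Y\<in>S. f Y = Y" using r by (intro Banach_fix) auto
  then obtain Y where Y: "Y \<in> S" "f Y = Y" by blast
  have YY: "blinfun_apply Y v = (1/2) *\<^sub>R (blinfun_apply H v + blinfun_apply Y (blinfun_apply Y v))" for v
    using Y(2) by (metis f_def blinfun.add_left blinfun.scaleR_left blinfun_apply_blinfun_compose)
  have symY: "Y v \<bullet> w = v \<bullet> Y w" for v w using Y(1) by (simp add: S_def)
  define X where "X = K *\<^sub>R (id_blinfun - Y)"
  have "X v \<bullet> w = v \<bullet> X w" for v w
    by (simp add: X_def blinfun.diff_left blinfun.scaleR_left inner_simps symY)
  moreover have "0 \<le> v \<bullet> X v" for v
  proof -
    have "v \<bullet> Y v \<le> norm v * norm (Y v)" by (rule norm_cauchy_schwarz)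
    also have "\<dots> \<le> norm v * (1 * norm v)"
      using Y(1) r by (intro mult_left_mono order_trans[OF norm_blinfun] mult_right_mono) (auto simp: S_def)
    finally have "v \<bullet> Y v \<le> v \<bullet> v" by (simp add: dot_square_norm power2_eq_square)
    thus ?thesis using K by (simp add: X_def blinfun.diff_left blinfun.scaleR_left inner_simps)
  qed
  moreover have "X o\<^sub>L X = T"
  proof (rule blinfun_eqI)
    fix v
    \<comment> \<open>The fixed point equation solved for the square of \<open>Y\<close>; it makes
      \<open>(1 - Y)\<^sup>2 = 1 - 2 Y + Y\<^sup>2\<close> equal to \<open>1 - H\<close>.\<close>
    have YYv: "Y (Y v) = 2 *\<^sub>R Y v - H v" using arg_cong[OF YY[of v], of "\<lambda>z. 2 *\<^sub>R z"] by simp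
    have "(X o\<^sub>L X) v = K\<^sup>2 *\<^sub>R (v - Y v - (Y v - Y (Y v)))"
      by (simp add: X_def blinfun.bilinear_simps power2_eq_square scaleR_diff_right)
    also have "v - Y v - (Y v - Y (Y v)) = v - H v" by (simp add: YYv scaleR_2)
    also have "K\<^sup>2 *\<^sub>R (v - H v) = T v" using K by (simp add: H_def blinfun.diff_left blinfun.scaleR_left)
    finally show "(X o\<^sub>L X) v = T v" .
  qed
  ultimately show ?thesis by (intro exI[of _ X] conjI allI)
qed

text \<open>A nonnegative form vanishing at \<open>v\<close> is minimal there. Testing it at
  \<open>v - a *\<^sub>R w\<close> with \<open>w = X *v v\<close> leaves
  \<open>a * (a * c - 2 * s)\<close>, which is negative for small positive \<open>a\<close> unless
  \<open>s = w \<bullet> w\<close> vanishes.\<close>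

lemma psd_kernel:
  assumes "sym_matrix X" "loewner_le 0 X" "v \<bullet> (X *v v) = 0"
  shows "X *v v = 0"
proof (rule ccontr)
  assume nz: "X *v v \<noteq> 0"
  define w where "w = X *v v"
  define c where "c = w \<bullet> (X *v w)"
  define s where "s = w \<bullet> w"
  have s: "s > 0" using nz by (simp add: s_def w_def)
  have c: "c \<ge> 0" using assms(2) by (simp add: c_def loewner_le_def)
  have vw: "v \<bullet> (X *v w) = s" using dot_sym_matrix[OF assms(1), of v w] by (simp add: w_def s_def)
  have "0 \<le> (v - a *\<^sub>R w) \<bullet> (X *v (v - a *\<^sub>R w))" for a
    using assms(2) by (simp add: loewner_le_def)
  hence *: "0 \<le> a * (a * c - 2 * s)" for a
    using assms(3) vw by (simp add: matrix_vector_mult_diff_distrib matrix_vector_mult_scaleR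
        inner_simps c_def s_def algebra_simps flip: w_def)
  \<comment> \<open>The \<open>+ 1\<close> keeps the denominator positive when \<open>c = 0\<close>;
    the second factor is then at most \<open>- s\<close>.\<close>
  have "0 \<le> (s / (c + 1)) * ((s / (c + 1)) * c - 2 * s)" by (rule *)
  moreover have "(s / (c + 1)) * c \<le> s" using s c by (simp add: field_simps)
  ultimately show False using s c by (smt (verit) divide_pos_pos mult_pos_neg)
qed

text \<open>Symmetry identifies row \<open>i\<close> of \<open>D\<close> with column
  \<open>i\<close>. The point of the formula is that a positive semidefinite \<open>X\<close> makes
  every summand nonnegative.\<close>

lemma trace_conj_eq:
  assumes "sym_matrix D"
  shows "trace (D ** X ** D) = (\<Sum>i\<in>UNIV. column i D \<bullet> (X *v column i D))"
proof -
  have "(D ** X ** D) $ i $ i = column i D \<bullet> (X *v column i D)" for i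
    unfolding matrix_mult_dot[of D] matrix_mul_assoc[symmetric] 
    using assms unfolding sym_matrix_def transpose_def
    by (simp add: row_def column_def matrix_matrix_mult_def matrix_vector_mult_def inner_vec_def vec_eq_iff)
  thus ?thesis by (simp add: trace_def)
qed

text \<open>With \<open>D = X - Y\<close> we have \<open>X D + D Y = X\<^sup>2 - Y\<^sup>2 = 0\<close>; multiplying by \<open>D\<close> and taking traces gives
  \<open>tr (D X D) + tr (D Y D) = 0\<close> with both summands nonnegative.\<close>

lemma psd_sqrt_unique:
  assumes X: "sym_matrix X" "loewner_le 0 X" and Y: "sym_matrix Y" "loewner_le 0 Y"
    and eq: "X ** X = Y ** Y" and pd: "loewner_le (mat 1) (X ** X)"
  shows "X = Y"
proof -
  define D where "D = X - Y"
  have D: "sym_matrix D" using X Y by (simp add: D_def sym_matrix_def transpose_def vec_eq_iff)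
  have "X ** D + D ** Y = 0"
  proof (rule matrix_eq[THEN iffD2], rule allI)
    fix v
    have "X *v (X *v v) = Y *v (Y *v v)" by (simp add: matrix_vector_mul_assoc eq)
    thus "(X ** D + D ** Y) *v v = 0 *v v"
      by (simp add: D_def matrix_vector_mult_add_rdistrib matrix_vector_mult_diff_rdistrib
          matrix_vector_mult_diff_distrib flip: matrix_vector_mul_assoc)
  qed
  hence "D ** (X ** D + D ** Y) = 0" by simp
  hence "D ** X ** D + D ** (D ** Y) = 0" by (simp add: matrix_add_ldistrib matrix_mul_assoc)
  hence "trace (D ** X ** D) + trace (D ** Y ** D) = 0"
    using trace_mul_sym[of D "D ** Y"]
      trace_add[of "D ** X ** D" "D ** (D ** Y)"] by (simp add: trace_def)
  moreover have nn: "0 \<le> v \<bullet> (X *v v)" "0 \<le> v \<bullet> (Y *v v)" for v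
    using X Y by (auto simp: loewner_le_def)
  moreover from nn have "trace (D ** X ** D) \<ge> 0" "trace (D ** Y ** D) \<ge> 0"
    by (auto simp: trace_conj_eq[OF D] intro: sum_nonneg)
  ultimately have "trace (D ** X ** D) = 0" by linarith
  hence "column i D \<bullet> (X *v column i D) = 0" for i
    using nn by (simp add: trace_conj_eq[OF D] sum_nonneg_eq_0_iff)
  hence "X *v column i D = 0" for i using psd_kernel[OF X] by blast
  \<comment> \<open>The hypothesis \<open>pd\<close> turns a column annihilated by \<open>X\<close>
    into a zero column.\<close>
  hence "(X ** X) *v column i D = 0" for i by (simp flip: matrix_vector_mul_assoc)
  hence "column i D \<bullet> column i D \<le> 0" for i
    using pd[unfolded loewner_le_def, rule_format, of "column i D"] by simp
  hence "column i D = 0" for i using inner_gt_zero_iff[of "column i D"] by (simp add: not_le[symmetric])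
  thus ?thesis by (simp add: D_def column_def vec_eq_iff)
qed

text \<open>\<open>psd_sqrt\<close> is a definite description, so existence and uniqueness must both
  be known before its properties can be used. Existence is carried over from operators to
  matrices.\<close>

lemma psd_sqrt:
  assumes "sym_matrix Q" "loewner_le (mat 1) Q"
  shows "sym_matrix (psd_sqrt Q)" "psd_sqrt Q ** psd_sqrt Q = Q"
proof -
  define T where "T = Blinfun ((*v) Q)"
  have T: "blinfun_apply T v = Q *v v" for v
    unfolding T_def by (rule fun_cong[OF bounded_linear_Blinfun_apply]) (rule matrix_vector_mul_bounded_linear)
  have "\<exists>X. (\<forall>v w. blinfun_apply X v \<bullet> w = v \<bullet> X w) \<and> (\<forall>v. 0 \<le> v \<bullet> X v) \<and> X o\<^sub>L X = T"
    by (rule self_adjoint_sqrt_exists)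
      (use assms(2) in \<open>simp_all add: T dot_sym_matrix[OF assms(1)] loewner_le_def\<close>)
  then obtain X where X: "\<forall>v w. blinfun_apply X v \<bullet> w = v \<bullet> X w" "\<forall>v. 0 \<le> v \<bullet> X v" "X o\<^sub>L X = T"
    by (elim exE conjE)
  define M where "M = matrix (blinfun_apply X)"
  have M: "M *v v = X v" for v
    unfolding M_def by (rule fun_cong[OF matrix_vector_mul(3)[OF blinfun.bounded_linear_right]])
  have "(M ** M) *v v = Q *v v" for v
    using arg_cong[OF X(3), of "\<lambda>Z. blinfun_apply Z v"] by (simp add: M T flip: matrix_vector_mul_assoc)
  hence "M ** M = Q" by (simp add: matrix_eq)
  moreover have "sym_matrix M"
  proof -
    have "transpose M *v v = M *v v" for v
    proof -
      have "(transpose M *v v) \<bullet> w = (M *v v) \<bullet> w" for w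
        using X(1)[rule_format, of v w] by (simp only: transpose_matrix_vector dot_lmul_matrix M)
      thus ?thesis using vector_eq_rdot[of "transpose M *v v" "M *v v"] by metis
    qed
    thus ?thesis unfolding sym_matrix_def matrix_eq by blast
  qed
  moreover have "loewner_le 0 M" using X(2) by (simp add: loewner_le_def M)
  ultimately have "\<exists>!X. sym_matrix X \<and> loewner_le 0 X \<and> X ** X = Q"
  proof (intro ex1I[of _ M] conjI)
    fix Y assume MM: "M ** M = Q" "sym_matrix M" "loewner_le 0 M"
      and Y: "sym_matrix Y \<and> loewner_le 0 Y \<and> Y ** Y = Q"
    have "loewner_le (mat 1) (Y ** Y)" "Y ** Y = M ** M" using MM Y assms(2) by simp_all
    with MM Y show "Y = M" using psd_sqrt_unique[of Y M] by blast
  qed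
  from theI'[OF this] show "sym_matrix (psd_sqrt Q)" "psd_sqrt Q ** psd_sqrt Q = Q"
    unfolding psd_sqrt_def by blast+
qed

subsection \<open>Differential inequalities with two time scales\<close>

text \<open>Fits the derivatives in \<open>solution_H\<close>, taken within a half-open interval: at
  interior points they are two-sided, and at \<open>a\<close> only the continuity they imply
  enters.\<close>

lemma DERIV_nonpos_imp_antimono_atLeastLessThan:
  fixes p :: "real \<Rightarrow> real"
  assumes der: "\<And>s. s \<in> {a..<b} \<Longrightarrow> \<exists>d\<le>0. (p has_real_derivative d) (at s within {a..<b})"
    and s: "a \<le> s" "s < b"
  shows "p s \<le> p a"
proof (rule DERIV_nonpos_imp_decreasing_open[OF s(1)])
    fix x assume x: "a < x" "x < s"
    obtain d where d: "d \<le> 0" "(p has_real_derivative d) (at x within {a..<b})"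
      using der[of x] x s by auto
    have "(p has_real_derivative d) (at x within {a<..<b})"
      using d(2) by (rule has_field_derivative_subset) auto
    thus "\<exists>y. (p has_real_derivative y) (at x) \<and> y \<le> 0"
      using d(1) x s by (metis at_within_open greaterThanLessThan_iff less_trans open_greaterThanLessThan)
  next
    have "continuous_on {a..<b} p"
      using der by (meson DERIV_continuous continuous_on_eq_continuous_within)
    thus "continuous_on {a..s} p" by (rule continuous_on_subset) (use s in auto)
qed

text \<open>Integrating factor argument: \<open>p\<close> is
  \<open>exp (\<mu> * (s - a)) * h s\<close> minus antiderivatives of the two forcing terms, hence
  nonincreasing. \<open>D\<close> will be a regularisation error, \<open>E\<close> the influence of
  the slow state on the fast one.\<close>

lemma linear_decay_comparison:
  fixes h :: "real \<Rightarrow> real"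
  assumes der: "\<And>s. s \<in> {a..<b} \<Longrightarrow> \<exists>d. (h has_real_derivative d) (at s within {a..<b}) \<and>
      d \<le> - \<mu> * h s + D + E * exp (- \<alpha> * (s - a))"
    and pos: "\<mu> > 0" "\<mu> > \<alpha>" "D \<ge> 0" "E \<ge> 0" and s: "a \<le> s" "s < b"
  shows "h s \<le> exp (- \<mu> * (s - a)) * h a + D / \<mu> + E / (\<mu> - \<alpha>) * exp (- \<alpha> * (s - a))"
proof -
  define p where "p s = exp (\<mu> * (s - a)) * h s - D / \<mu> * exp (\<mu> * (s - a))
      - E / (\<mu> - \<alpha>) * exp ((\<mu> - \<alpha>) * (s - a))" for s
  have "p s \<le> p a"
  proof (rule DERIV_nonpos_imp_antimono_atLeastLessThan[OF _ s])
    fix r assume "r \<in> {a..<b}"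
    then obtain d where d: "(h has_real_derivative d) (at r within {a..<b})"
      "d \<le> - \<mu> * h r + D + E * exp (- \<alpha> * (r - a))" using der by blast
    have eq: "exp ((\<mu> - \<alpha>) * (r - a)) = exp (\<mu> * (r - a)) * exp (- \<alpha> * (r - a))"
      by (simp add: algebra_simps flip: exp_add)
    have "(p has_real_derivative exp (\<mu> * (r - a)) * (d + \<mu> * h r - D - E * exp (- \<alpha> * (r - a))))
        (at r within {a..<b})"
      unfolding p_def using d(1) pos
      by (auto intro!: derivative_eq_intros simp: eq) (simp add: field_simps)
    moreover have "exp (\<mu> * (r - a)) * (d + \<mu> * h r - D - E * exp (- \<alpha> * (r - a))) \<le> 0"
      using d(2) by (intro mult_nonneg_nonpos) auto
    ultimately show "\<exists>d\<le>0. (p has_real_derivative d) (at r within {a..<b})" by blast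
  qed
  also have "p a \<le> h a"
  proof -
    have "D / \<mu> \<ge> 0" "E / (\<mu> - \<alpha>) \<ge> 0" using pos by auto
    thus ?thesis by (simp add: p_def)
  qed
  finally have "exp (- \<mu> * (s - a)) * p s \<le> exp (- \<mu> * (s - a)) * h a"
    by (intro mult_left_mono) auto
  moreover have "exp (- \<mu> * (s - a)) * p s
      = h s - D / \<mu> - E / (\<mu> - \<alpha>) * exp (- \<alpha> * (s - a))"
    unfolding p_def by (simp add: right_diff_distrib mult.assoc[symmetric] exp_minus_inverse
        mult.commute[of "exp _" "_ / _"] flip: exp_add) (simp add: algebra_simps flip: exp_add)
  ultimately show ?thesis by linarith
qed

section \<open>Regularised square roots and the coupled scalar inequalities\<close>

lemma le_if_le_plus_multiple:
  fixes x y C :: real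
  assumes "\<And>\<delta>. \<delta> > 0 \<Longrightarrow> x \<le> y + C * \<delta>"
  shows "x \<le> y"
proof (rule field_le_epsilon)
  fix e :: real assume e: "e > 0"
  have "x \<le> y + C * (e / (\<bar>C\<bar> + 1))" using e by (intro assms) auto
  also have "C * (e / (\<bar>C\<bar> + 1)) \<le> \<bar>C\<bar> * (e / (\<bar>C\<bar> + 1))"
    using e by (intro mult_right_mono) auto
  also have "\<dots> \<le> e" using e by (simp add: field_simps)
  finally show "x \<le> y + e" by simp
qed

lemma sqrt_add_square_le: "0 \<le> f \<Longrightarrow> 0 \<le> \<delta> \<Longrightarrow> sqrt (f + \<delta>\<^sup>2) \<le> sqrt f + \<delta>"
  by (metis abs_of_nonneg real_sqrt_abs sqrt_add_le_add_sqrt zero_le_power2)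

text \<open>The square roots below need not be differentiable where they vanish, so we work with
  \<open>sqrt (f + \<delta>\<^sup>2)\<close> and let \<open>\<delta>\<close> tend to \<open>0\<close>.\<close>

lemma regularised_sqrt_derivative:
  fixes f :: "real \<Rightarrow> real"
  assumes f: "(f has_real_derivative d) (at s within T)" "f s \<ge> 0" "\<delta> > 0"
    and d: "d \<le> 2 * w * sqrt (f s) - 2 * l * f s" and w: "w \<ge> 0" "l \<ge> 0"
  shows "\<exists>d'. ((\<lambda>r. sqrt (f r + \<delta>\<^sup>2)) has_real_derivative d') (at s within T) \<and>
      d' \<le> - l * sqrt (f s + \<delta>\<^sup>2) + (w + l * \<delta>)"
proof (intro exI conjI)
  define F where "F = sqrt (f s + \<delta>\<^sup>2)"
  have pos: "f s + \<delta>\<^sup>2 > 0" using f by (simp add: add_nonneg_pos)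
  have F: "F \<ge> sqrt (f s)" "F \<ge> \<delta>" "F > 0" "F * F = f s + \<delta>\<^sup>2"
    using f pos by (auto simp: F_def intro: real_le_rsqrt)
  show "((\<lambda>r. sqrt (f r + \<delta>\<^sup>2)) has_real_derivative d / (2 * F)) (at s within T)"
    unfolding F_def using f(1) pos by (auto intro!: derivative_eq_intros simp: field_simps)
  \<comment> \<open>\<open>f s\<close> is replaced by \<open>F * F - \<delta>\<^sup>2\<close>, and
    \<open>\<delta> \<le> F\<close> makes the error a multiple of \<open>F\<close>, ready for
    division by \<open>2 * F\<close>.\<close>
  have "d \<le> 2 * w * F - 2 * l * (F * F) + 2 * l * (\<delta> * F)"
  proof -
    have "w * sqrt (f s) \<le> w * F" using F w by (intro mult_left_mono)
    moreover have "l * (\<delta> * \<delta>) \<le> l * (\<delta> * F)" using F w f by (intro mult_left_mono) auto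
    ultimately show ?thesis using d F(4) by (simp add: algebra_simps power2_eq_square)
  qed
  also have "\<dots> = (2 * F) * (- l * F + (w + l * \<delta>))" by (simp add: algebra_simps)
  finally have "d / (2 * F) \<le> - l * F + (w + l * \<delta>)" using F(3) by (simp add: divide_le_eq mult.commute)
  thus "d / (2 * F) \<le> - l * sqrt (f s + \<delta>\<^sup>2) + (w + l * \<delta>)" by (simp add: F_def)
qed

text \<open>In \<open>sqrt f + \<kappa> * sqrt g\<close> the slow part collects the coefficient
  \<open>\<kappa> * \<beta> - l = - \<alpha>\<close> and the fast part
  \<open>\<beta> - \<kappa> * \<mu> \<le> - \<alpha> * \<kappa>\<close>, so the sum decays at rate
  \<open>\<alpha>\<close>. This decay is then an exponential forcing in the inequality for
  \<open>sqrt g\<close> alone.\<close>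

lemma two_time_scale_decay:
  fixes f g :: "real \<Rightarrow> real"
  assumes f: "\<And>s. s \<in> {a..<b} \<Longrightarrow> \<exists>d. (f has_real_derivative d) (at s within {a..<b}) \<and>
        d \<le> 2 * \<beta> * sqrt (f s) * sqrt (g s) - 2 * l * f s"
    and g: "\<And>s. s \<in> {a..<b} \<Longrightarrow> \<exists>d. (g has_real_derivative d) (at s within {a..<b}) \<and>
        d \<le> 2 * \<beta> * sqrt (f s) * sqrt (g s) - 2 * \<mu> * g s"
    and nn: "\<And>s. f s \<ge> 0" "\<And>s. g s \<ge> 0"
    and pos: "\<beta> \<ge> 0" "l \<ge> 0" "\<mu> \<ge> 0" "\<kappa> \<ge> 0" "\<alpha> > 0" "\<mu> > \<alpha>"
    and lam: "\<alpha> = l - \<kappa> * \<beta>" "\<beta> + \<alpha> * \<kappa> \<le> \<kappa> * \<mu>"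
    and s: "a \<le> s" "s < b"
  shows "sqrt (f s) + \<kappa> * sqrt (g s) \<le> exp (- \<alpha> * (s - a)) * (sqrt (f a) + \<kappa> * sqrt (g a))"
    and "sqrt (g s) \<le> exp (- \<mu> * (s - a)) * sqrt (g a)
        + \<beta> / (\<mu> - \<alpha>) * exp (- \<alpha> * (s - a)) * (sqrt (f a) + \<kappa> * sqrt (g a))"
proof -
  define V where "V = sqrt (f a) + \<kappa> * sqrt (g a)"
  have V0: "V \<ge> 0" using nn pos by (simp add: V_def)
  have *: "sqrt (f s) + \<kappa> * sqrt (g s) \<le> exp (- \<alpha> * (s - a)) * V" if s: "a \<le> s" "s < b" for s
  proof (rule le_if_le_plus_multiple)
    fix \<delta> :: real assume d: "\<delta> > 0"
    define h where "h r = sqrt (f r + \<delta>\<^sup>2) + \<kappa> * sqrt (g r + \<delta>\<^sup>2)" for r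
    \<comment> \<open>Comparison at decay rate \<open>\<alpha>\<close>, with the exponential forcing
      switched off: \<open>E = 0\<close> and forcing rate \<open>0\<close>.\<close>
    have "h s \<le> exp (- \<alpha> * (s - a)) * h a + (l + \<kappa> * \<mu>) * \<delta> / \<alpha> + 0 / (\<alpha> - 0) * exp (- 0 * (s - a))"
    proof (rule linear_decay_comparison[OF _ _ _ _ _ s])
      fix r assume r: "r \<in> {a..<b}"
      define F where "F = sqrt (f r + \<delta>\<^sup>2)"
      define G where "G = sqrt (g r + \<delta>\<^sup>2)"
      have FG: "sqrt (f r) \<le> F" "sqrt (g r) \<le> G" "0 \<le> F" "0 \<le> G"
        using nn by (auto simp: F_def G_def)
      obtain d1 where d1: "(f has_real_derivative d1) (at r within {a..<b})"
        "d1 \<le> 2 * (\<beta> * sqrt (g r)) * sqrt (f r) - 2 * l * f r"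
        using f[OF r] by (auto simp: mult_ac)
      obtain d2 where d2: "(g has_real_derivative d2) (at r within {a..<b})"
        "d2 \<le> 2 * (\<beta> * sqrt (f r)) * sqrt (g r) - 2 * \<mu> * g r"
        using g[OF r] by (auto simp: mult_ac)
      obtain e1 where e1: "((\<lambda>r. sqrt (f r + \<delta>\<^sup>2)) has_real_derivative e1) (at r within {a..<b})"
        "e1 \<le> - l * F + (\<beta> * sqrt (g r) + l * \<delta>)"
        using regularised_sqrt_derivative[OF d1(1) nn(1) d d1(2)] pos nn unfolding F_def by auto
      obtain e2 where e2: "((\<lambda>r. sqrt (g r + \<delta>\<^sup>2)) has_real_derivative e2) (at r within {a..<b})"
        "e2 \<le> - \<mu> * G + (\<beta> * sqrt (f r) + \<mu> * \<delta>)"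
        using regularised_sqrt_derivative[OF d2(1) nn(2) d d2(2)] pos nn unfolding G_def by auto
      have "(h has_real_derivative e1 + \<kappa> * e2) (at r within {a..<b})"
        unfolding h_def by (intro DERIV_add DERIV_cmult e1(1) e2(1))
      moreover have "e1 + \<kappa> * e2 \<le> - \<alpha> * (F + \<kappa> * G) + (l + \<kappa> * \<mu>) * \<delta>"
      proof -
        have "e1 \<le> - l * F + (\<beta> * G + l * \<delta>)"
          using e1(2) mult_left_mono[OF FG(2) pos(1)] by linarith
        moreover have "e2 \<le> - \<mu> * G + (\<beta> * F + \<mu> * \<delta>)"
          using e2(2) mult_left_mono[OF FG(1) pos(1)] by linarith
        then have "\<kappa> * e2 \<le> \<kappa> * (- \<mu> * G + (\<beta> * F + \<mu> * \<delta>))" using pos by (intro mult_left_mono)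
        moreover have "(\<beta> + \<alpha> * \<kappa>) * G \<le> \<kappa> * \<mu> * G" using lam(2) FG by (intro mult_right_mono)
        moreover have "l * F = \<alpha> * F + \<kappa> * (\<beta> * F)" unfolding lam(1) by (simp add: algebra_simps)
        ultimately show ?thesis by (simp add: algebra_simps)
      qed
      ultimately show "\<exists>d. (h has_real_derivative d) (at r within {a..<b}) \<and>
          d \<le> - \<alpha> * h r + (l + \<kappa> * \<mu>) * \<delta> + 0 * exp (- 0 * (r - a))"
        by (auto simp: h_def F_def G_def)
    qed (use pos d in auto)
    moreover have "sqrt (f s) + \<kappa> * sqrt (g s) \<le> h s"
      unfolding h_def using pos by (intro add_mono mult_left_mono) auto
    moreover have "exp (- \<alpha> * (s - a)) * h a \<le> exp (- \<alpha> * (s - a)) * V + 1 * ((1 + \<kappa>) * \<delta>)"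
    proof -
      have "h a \<le> (sqrt (f a) + \<delta>) + \<kappa> * (sqrt (g a) + \<delta>)"
        unfolding h_def using pos nn d by (intro add_mono mult_left_mono sqrt_add_square_le) auto
      hence "h a \<le> V + (1 + \<kappa>) * \<delta>" by (simp add: V_def algebra_simps)
      hence "exp (- \<alpha> * (s - a)) * h a \<le> exp (- \<alpha> * (s - a)) * (V + (1 + \<kappa>) * \<delta>)" by simp
      moreover have "exp (- \<alpha> * (s - a)) * ((1 + \<kappa>) * \<delta>) \<le> 1 * ((1 + \<kappa>) * \<delta>)"
        using pos d s by (intro mult_right_mono) auto
      ultimately show ?thesis by (simp add: distrib_left)
    qed
    ultimately show "sqrt (f s) + \<kappa> * sqrt (g s)
        \<le> exp (- \<alpha> * (s - a)) * V + ((1 + \<kappa>) + (l + \<kappa> * \<mu>) / \<alpha>) * \<delta>"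
      by (simp add: algebra_simps add_divide_distrib)
  qed
  show "sqrt (f s) + \<kappa> * sqrt (g s) \<le> exp (- \<alpha> * (s - a)) * (sqrt (f a) + \<kappa> * sqrt (g a))"
    using *[OF s] by (simp add: V_def)
  have "sqrt (g s) \<le> exp (- \<mu> * (s - a)) * sqrt (g a) + \<beta> * V / (\<mu> - \<alpha>) * exp (- \<alpha> * (s - a))"
  proof (rule le_if_le_plus_multiple)
    fix \<delta> :: real assume d: "\<delta> > 0"
    define h where "h r = sqrt (g r + \<delta>\<^sup>2)" for r
    \<comment> \<open>Comparison at decay rate \<open>\<mu>\<close>:
      \<open>D = \<mu> * \<delta>\<close> is the regularisation error, and
      \<open>E = \<beta> * V\<close> comes from the decay of the sum.\<close>
    have "h s \<le> exp (- \<mu> * (s - a)) * h a + \<mu> * \<delta> / \<mu> + \<beta> * V / (\<mu> - \<alpha>) * exp (- \<alpha> * (s - a))"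
    proof (rule linear_decay_comparison[OF _ _ _ _ _ s])
      fix r assume r: "r \<in> {a..<b}"
      obtain d2 where d2: "(g has_real_derivative d2) (at r within {a..<b})"
        "d2 \<le> 2 * (\<beta> * sqrt (f r)) * sqrt (g r) - 2 * \<mu> * g r"
        using g[OF r] by (auto simp: mult_ac)
      obtain e2 where e2: "((\<lambda>r. sqrt (g r + \<delta>\<^sup>2)) has_real_derivative e2) (at r within {a..<b})"
        "e2 \<le> - \<mu> * h r + (\<beta> * sqrt (f r) + \<mu> * \<delta>)"
        using regularised_sqrt_derivative[OF d2(1) nn(2) d d2(2)] pos nn unfolding h_def by auto
      have "sqrt (f r) \<le> exp (- \<alpha> * (r - a)) * V"
        using *[of r] r pos nn by (smt (verit) atLeastLessThan_iff mult_nonneg_nonneg real_sqrt_ge_zero)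
      hence "\<beta> * sqrt (f r) \<le> \<beta> * (exp (- \<alpha> * (r - a)) * V)" using pos by (intro mult_left_mono)
      thus "\<exists>d. (h has_real_derivative d) (at r within {a..<b}) \<and>
          d \<le> - \<mu> * h r + \<mu> * \<delta> + \<beta> * V * exp (- \<alpha> * (r - a))"
        using e2 unfolding h_def by (intro exI[of _ e2]) (auto simp: mult_ac)
    qed (use pos d V0 in auto)
    moreover have "sqrt (g s) \<le> h s" unfolding h_def by simp
    moreover have "exp (- \<mu> * (s - a)) * h a \<le> exp (- \<mu> * (s - a)) * sqrt (g a) + 1 * \<delta>"
    proof -
      have "h a \<le> sqrt (g a) + \<delta>"
        unfolding h_def using nn d by (intro sqrt_add_square_le) auto
      hence "exp (- \<mu> * (s - a)) * h a \<le> exp (- \<mu> * (s - a)) * (sqrt (g a) + \<delta>)" by simp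
      moreover have "exp (- \<mu> * (s - a)) * \<delta> \<le> 1 * \<delta>"
        using pos d s by (intro mult_right_mono) auto
      ultimately show ?thesis by (simp add: distrib_left)
    qed
    ultimately show "sqrt (g s)
        \<le> exp (- \<mu> * (s - a)) * sqrt (g a) + \<beta> * V / (\<mu> - \<alpha>) * exp (- \<alpha> * (s - a)) + 2 * \<delta>"
      using pos by simp
  qed
  thus "sqrt (g s) \<le> exp (- \<mu> * (s - a)) * sqrt (g a)
      + \<beta> / (\<mu> - \<alpha>) * exp (- \<alpha> * (s - a)) * (sqrt (f a) + \<kappa> * sqrt (g a))"
    by (simp add: V_def mult_ac)
qed

subsection \<open>Weighted norms and quadratic forms\<close>

lemma block_mult_join_vec:
  fixes R :: "real^('x::finite + 'z::finite)^('x + 'z)"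
  assumes "join_vec x y = R *v join_vec u v"
  shows "x = block11 R *v u + block12 R *v v" "y = block21 R *v u + block22 R *v v"
proof -
  have split: "(\<Sum>c\<in>UNIV. h c) = (\<Sum>a\<in>UNIV. h (Inl a)) + (\<Sum>b\<in>UNIV. h (Inr b))"
    for h :: "'x + 'z \<Rightarrow> real"
    by (simp add: UNIV_Plus_UNIV[symmetric] sum.Plus del: UNIV_Plus_UNIV)
  have "join_vec x y $ c = (R *v join_vec u v) $ c" for c using assms by simp
  from this[of "Inl _"] this[of "Inr _"]
  show "x = block11 R *v u + block12 R *v v" "y = block21 R *v u + block22 R *v v"
    by (simp_all add: vec_eq_iff matrix_vector_mult_def join_vec_def split
        block11_def block12_def block21_def block22_def)
qed

lemma norm_psd_sqrt_mult:
  assumes "sym_matrix Q" "loewner_le (mat 1) Q"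
  shows "(norm (psd_sqrt Q *v v))\<^sup>2 = v \<bullet> (Q *v v)" "norm v \<le> norm (psd_sqrt Q *v v)"
proof -
  show *: "(norm (psd_sqrt Q *v v))\<^sup>2 = v \<bullet> (Q *v v)"
    unfolding power2_norm_eq_inner dot_sym_matrix[OF psd_sqrt(1)[OF assms]]
    by (simp add: matrix_vector_mul_assoc psd_sqrt(2)[OF assms])
  have "(norm v)\<^sup>2 \<le> (norm (psd_sqrt Q *v v))\<^sup>2"
    unfolding * using assms(2) by (simp add: loewner_le_def power2_norm_eq_inner)
  thus "norm v \<le> norm (psd_sqrt Q *v v)" by (simp add: power2_le_iff_abs_le)
qed

lemma psd_sqrt_invertible:
  assumes "sym_matrix Q" "loewner_le (mat 1) Q"
  shows "invertible (psd_sqrt Q)"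
proof -
  have "v = 0" if "psd_sqrt Q *v v = 0" for v
    using norm_psd_sqrt_mult(2)[OF assms, of v] that by simp
  thus ?thesis by (meson invertible_left_inverse matrix_left_invertible_ker)
qed

lemma norm_matrix_vector_le: "norm (M *v v) \<le> spectral_norm M * norm v"
  for M :: "real^'n^'m"
  unfolding spectral_norm_def by (rule onorm[OF matrix_vector_mul_bounded_linear])

text \<open>Inserting \<open>matrix_inv X ** X\<close> in front of \<open>v\<close> produces the
  matrices in \<open>gamma11\<close>, so that the slow jump estimate keeps this sharp
  constant.\<close>

lemma weighted_norm_le:
  assumes "invertible X"
  shows "norm (Y *v (M *v v)) \<le> spectral_norm (Y ** M ** matrix_inv X) * norm (X *v v)"
proof -
  have "matrix_inv X ** X = mat 1"
    using someI_ex[OF assms[unfolded invertible_def]] by (simp add: matrix_inv_def)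
  hence "Y *v (M *v v) = (Y ** M ** matrix_inv X) *v (X *v v)"
    by (simp add: matrix_vector_mul_assoc flip: matrix_mul_assoc)
  thus ?thesis by (metis norm_matrix_vector_le)
qed

lemma quadratic_form_has_derivative:
  assumes "sym_matrix Q" and x: "(x has_vector_derivative x') (at s within T)"
  shows "((\<lambda>r. x r \<bullet> (Q *v x r)) has_real_derivative 2 * (x s \<bullet> (Q *v x'))) (at s within T)"
proof -
  have "((\<lambda>r. Q *v x r) has_vector_derivative Q *v x') (at s within T)"
    by (rule bounded_linear.has_vector_derivative[OF matrix_vector_mul_bounded_linear x])
  from bounded_bilinear.has_vector_derivative[OF bounded_bilinear_inner x this]
  have "((\<lambda>r. x r \<bullet> (Q *v x r)) has_vector_derivative x s \<bullet> (Q *v x') + x' \<bullet> (Q *v x s))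
      (at s within T)" .
  moreover have "x' \<bullet> (Q *v x s) = x s \<bullet> (Q *v x')"
    using dot_sym_matrix[OF assms(1), of x' "x s"] by (simp add: inner_commute)
  ultimately show ?thesis by (simp add: has_real_derivative_iff_has_vector_derivative)
qed

text \<open>By symmetry of \<open>Q\<close> both summands on the left of the Lyapunov inequality
  take the same value at \<open>v\<close>, and the factor \<open>2\<close> cancels.\<close>

lemma lyapunov_quadratic_form:
  assumes "loewner_le (transpose M ** Q + Q ** M) ((- 2 * l) *\<^sub>R Q)" "sym_matrix Q"
  shows "v \<bullet> (Q *v (M *v v)) \<le> - l * (v \<bullet> (Q *v v))"
proof -
  have "v \<bullet> ((transpose M ** Q + Q ** M) *v v) \<le> v \<bullet> (((- 2 * l) *\<^sub>R Q) *v v)"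
    using assms(1) unfolding loewner_le_def by blast
  moreover have "v \<bullet> (((- 2 * l) *\<^sub>R Q) *v v) = - 2 * l * (v \<bullet> (Q *v v))"
    by (simp only: scaleR_matrix_vector_assoc[symmetric] inner_scaleR_right)
  moreover have "v \<bullet> ((transpose M ** Q) *v v) = v \<bullet> (Q *v (M *v v))"
  proof -
    have "v \<bullet> ((transpose M ** Q) *v v) = ((Q *v v) v* M) \<bullet> v"
      by (simp add: inner_commute flip: matrix_vector_mul_assoc)
    thus ?thesis by (simp add: dot_lmul_matrix dot_sym_matrix[OF assms(2)])
  qed
  ultimately show ?thesis
    by (simp add: matrix_vector_mult_add_rdistrib inner_simps
        flip: matrix_vector_mul_assoc)
qed

text \<open>Cauchy-Schwarz after splitting \<open>Q\<close> into two roots. As weighted norms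
  dominate plain ones, \<open>w\<close> can be taken to be a weighted norm of
  \<open>u\<close>.\<close>

lemma weighted_inner_le:
  assumes Q: "sym_matrix Q" "loewner_le (mat 1) Q"
    and "spectral_norm (psd_sqrt Q ** M) \<le> \<beta>" "norm u \<le> w"
  shows "v \<bullet> (Q *v (M *v u)) \<le> \<beta> * norm (psd_sqrt Q *v v) * w"
proof -
  have "Q *v (M *v u) = psd_sqrt Q *v (psd_sqrt Q *v (M *v u))"
    by (metis matrix_vector_mul_assoc psd_sqrt(2)[OF Q])
  hence "v \<bullet> (Q *v (M *v u)) = (psd_sqrt Q *v v) \<bullet> ((psd_sqrt Q ** M) *v u)"
    by (simp add: dot_sym_matrix[OF psd_sqrt(1)[OF Q]] flip: matrix_vector_mul_assoc)
  also have "\<dots> \<le> norm (psd_sqrt Q *v v) * norm ((psd_sqrt Q ** M) *v u)"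
    by (rule norm_cauchy_schwarz)
  also have "\<dots> \<le> norm (psd_sqrt Q *v v) * (\<beta> * w)"
  proof (intro mult_left_mono)
    have "0 \<le> spectral_norm (psd_sqrt Q ** M)"
      unfolding spectral_norm_def by (rule onorm_pos_le[OF matrix_vector_mul_bounded_linear])
    thus "norm ((psd_sqrt Q ** M) *v u) \<le> \<beta> * w"
      using assms(3,4) by (intro order_trans[OF norm_matrix_vector_le] mult_mono) auto
  qed simp
  finally show ?thesis by (simp add: mult_ac)
qed

text \<open>Serves both time scales: \<open>c = 1\<close> for the slow state,
  \<open>c = 1 / \<epsilon>\<close> for the fast one, with \<open>u\<close> collecting the coupling.
  The rate \<open>l'\<close> of one mode may be lowered to a common \<open>l\<close> because the
  form of \<open>Q\<close> is nonnegative.\<close>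

lemma energy_derivative:
  assumes Q: "sym_matrix Q" "loewner_le (mat 1) Q"
    and lyap: "loewner_le (transpose M ** Q + Q ** M) ((- 2 * l') *\<^sub>R Q)" "l \<le> l'"
    and x: "(x has_vector_derivative c *\<^sub>R (M *v x s) + u) (at s within T)"
    and c: "c \<ge> 0" and u: "x s \<bullet> (Q *v u) \<le> w"
  shows "\<exists>d. ((\<lambda>r. (norm (psd_sqrt Q *v x r))\<^sup>2) has_real_derivative d) (at s within T) \<and>
      d \<le> 2 * w - 2 * (c * l) * (norm (psd_sqrt Q *v x s))\<^sup>2"
proof (intro exI conjI)
  show "((\<lambda>r. (norm (psd_sqrt Q *v x r))\<^sup>2) has_real_derivative
      2 * (x s \<bullet> (Q *v (c *\<^sub>R (M *v x s) + u)))) (at s within T)"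
    unfolding norm_psd_sqrt_mult(1)[OF Q] by (rule quadratic_form_has_derivative[OF Q(1) x])
  have "0 \<le> x s \<bullet> (Q *v x s)" by (simp flip: norm_psd_sqrt_mult(1)[OF Q])
  hence "l * (x s \<bullet> (Q *v x s)) \<le> l' * (x s \<bullet> (Q *v x s))" using lyap(2) by (rule mult_right_mono[rotated])
  hence "x s \<bullet> (Q *v (M *v x s)) \<le> - l * (x s \<bullet> (Q *v x s))"
    using lyapunov_quadratic_form[OF lyap(1) Q(1), of "x s"] by simp
  from mult_left_mono[OF this c] u
  show "2 * (x s \<bullet> (Q *v (c *\<^sub>R (M *v x s) + u))) \<le> 2 * w - 2 * (c * l) * (norm (psd_sqrt Q *v x s))\<^sup>2"
    unfolding norm_psd_sqrt_mult(1)[OF Q]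
    by (simp add: matrix_vector_right_distrib matrix_vector_mult_scaleR inner_simps)
qed

text \<open>The scalar estimate is applied to squared weighted norms. The \<open>B3\<close> term
  couples the fast state to itself and costs \<open>\<beta>\<close> of its decay rate, hence
  \<open>\<mu> = m / \<epsilon> - \<beta>\<close>.\<close>

lemma flow_estimate:
  fixes x :: "real \<Rightarrow> real^'x" and y :: "real \<Rightarrow> real^'z"
  assumes Qs: "sym_matrix Qs" "loewner_le (mat 1) Qs" and Qf: "sym_matrix Qf" "loewner_le (mat 1) Qf"
    and lyap: "loewner_le (transpose A0 ** Qs + Qs ** A0) ((- 2 * l') *\<^sub>R Qs)" "l \<le> l'"
      "loewner_le (transpose A22 ** Qf + Qf ** A22) ((- 2 * m') *\<^sub>R Qf)" "m \<le> m'"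
    and \<beta>: "spectral_norm (psd_sqrt Qs ** B1) \<le> \<beta>" "spectral_norm (psd_sqrt Qf ** B2) \<le> \<beta>"
      "spectral_norm (psd_sqrt Qf ** B3) \<le> \<beta>" and \<epsilon>: "\<epsilon> > 0"
    and ode: "\<And>s. s \<in> {a..<b} \<Longrightarrow> \<exists>x' y'.
        (x has_vector_derivative x') (at s within {a..<b}) \<and>
        (y has_vector_derivative y') (at s within {a..<b}) \<and>
        x' = A0 *v x s + B1 *v y s \<and>
        \<epsilon> *\<^sub>R y' = (\<epsilon> *\<^sub>R B2) *v x s + (A22 + \<epsilon> *\<^sub>R B3) *v y s"
    and pos: "\<beta> \<ge> 0" "l \<ge> 0" "\<mu> \<ge> 0" "\<kappa> \<ge> 0" "\<alpha> > 0" "\<mu> > \<alpha>"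
    and rates: "\<mu> = m / \<epsilon> - \<beta>" "\<alpha> = l - \<kappa> * \<beta>" "\<beta> + \<alpha> * \<kappa> \<le> \<kappa> * \<mu>"
    and s: "a \<le> s" "s < b"
  shows "norm (psd_sqrt Qs *v x s) + \<kappa> * norm (psd_sqrt Qf *v y s) \<le>
      exp (- \<alpha> * (s - a)) * (norm (psd_sqrt Qs *v x a) + \<kappa> * norm (psd_sqrt Qf *v y a))"
    and "norm (psd_sqrt Qf *v y s) \<le> exp (- \<mu> * (s - a)) * norm (psd_sqrt Qf *v y a)
        + \<beta> / (\<mu> - \<alpha>) * exp (- \<alpha> * (s - a)) *
          (norm (psd_sqrt Qs *v x a) + \<kappa> * norm (psd_sqrt Qf *v y a))"
proof -
  define f where "f r = (norm (psd_sqrt Qs *v x r))\<^sup>2" for r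
  define g where "g r = (norm (psd_sqrt Qf *v y r))\<^sup>2" for r
  have sq: "sqrt (f r) = norm (psd_sqrt Qs *v x r)" "sqrt (g r) = norm (psd_sqrt Qf *v y r)" for r
    by (simp_all add: f_def g_def)
  have f: "\<exists>d. (f has_real_derivative d) (at r within {a..<b}) \<and>
        d \<le> 2 * \<beta> * sqrt (f r) * sqrt (g r) - 2 * l * f r" if r: "r \<in> {a..<b}" for r
  proof -
    have "(x has_vector_derivative 1 *\<^sub>R (A0 *v x r) + B1 *v y r) (at r within {a..<b})"
      using ode[OF r] by auto
    from energy_derivative[OF Qs lyap(1,2) this _
        weighted_inner_le[OF Qs \<beta>(1) norm_psd_sqrt_mult(2)[OF Qf]]]
    show ?thesis unfolding sq by (simp add: f_def[abs_def] mult_ac)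
  qed
  have g: "\<exists>d. (g has_real_derivative d) (at r within {a..<b}) \<and>
        d \<le> 2 * \<beta> * sqrt (f r) * sqrt (g r) - 2 * \<mu> * g r" if r: "r \<in> {a..<b}" for r
  proof -
    obtain y' where y': "(y has_vector_derivative y') (at r within {a..<b})"
      "\<epsilon> *\<^sub>R y' = (\<epsilon> *\<^sub>R B2) *v x r + (A22 + \<epsilon> *\<^sub>R B3) *v y r"
      using ode[OF r] by blast
    have "y' = (1 / \<epsilon>) *\<^sub>R (\<epsilon> *\<^sub>R y')" using \<epsilon> by simp
    also have "\<dots> = (1 / \<epsilon>) *\<^sub>R (A22 *v y r) + (B2 *v x r + B3 *v y r)"
      unfolding y'(2) using \<epsilon>
      by (simp add: matrix_vector_mult_add_rdistrib scaleR_matrix_vector_assoc[symmetric]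
          scaleR_add_right)
    finally have "(y has_vector_derivative (1 / \<epsilon>) *\<^sub>R (A22 *v y r) + (B2 *v x r + B3 *v y r))
        (at r within {a..<b})" using y'(1) by simp
    moreover have "y r \<bullet> (Qf *v (B2 *v x r + B3 *v y r)) \<le> \<beta> * norm (psd_sqrt Qf *v y r) * norm (psd_sqrt Qs *v x r)
        + \<beta> * norm (psd_sqrt Qf *v y r) * norm (psd_sqrt Qf *v y r)"
      unfolding matrix_vector_right_distrib inner_add_right
      by (intro add_mono weighted_inner_le Qf \<beta> norm_psd_sqrt_mult(2) Qs)
    ultimately obtain d where "(g has_real_derivative d) (at r within {a..<b})"
      "d \<le> 2 * (\<beta> * norm (psd_sqrt Qf *v y r) * norm (psd_sqrt Qs *v x r)
        + \<beta> * norm (psd_sqrt Qf *v y r) * norm (psd_sqrt Qf *v y r)) - 2 * (1 / \<epsilon> * m) * g r"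
      using energy_derivative[OF Qf lyap(3,4), of y "1 / \<epsilon>" r] \<epsilon> unfolding g_def[abs_def] by fastforce
    thus ?thesis unfolding sq
      by (intro exI[of _ d]) (simp add: rates(1) g_def algebra_simps power2_eq_square)
  qed
  show "norm (psd_sqrt Qs *v x s) + \<kappa> * norm (psd_sqrt Qf *v y s) \<le>
      exp (- \<alpha> * (s - a)) * (norm (psd_sqrt Qs *v x a) + \<kappa> * norm (psd_sqrt Qf *v y a))"
    using two_time_scale_decay(1)[OF f g _ _ pos rates(2,3) s] unfolding sq by (simp add: f_def g_def)
  show "norm (psd_sqrt Qf *v y s) \<le> exp (- \<mu> * (s - a)) * norm (psd_sqrt Qf *v y a)
        + \<beta> / (\<mu> - \<alpha>) * exp (- \<alpha> * (s - a)) *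
          (norm (psd_sqrt Qs *v x a) + \<kappa> * norm (psd_sqrt Qf *v y a))"
    using two_time_scale_decay(2)[OF f g _ _ pos rates(2,3) s] unfolding sq by (simp add: f_def g_def)
qed

subsection \<open>Contraction over a period\<close>

lemma small_parameter_bounds:
  fixes \<beta> l m \<gamma> :: real
  assumes pos: "\<beta> \<ge> 1" "l > 0" "m > 0" "\<gamma> > 1"
  obtains \<epsilon>1 M p :: real where "\<epsilon>1 > 0" "M > 0" "p > 0"
    "\<And>\<epsilon> \<mu> \<kappa> \<alpha>. 0 < \<epsilon> \<Longrightarrow> \<epsilon> < \<epsilon>1 \<Longrightarrow> \<mu> = m / \<epsilon> - \<beta> \<Longrightarrow> \<kappa> = 2 * \<beta> * \<epsilon> / m \<Longrightarrow> \<alpha> = l - \<kappa> * \<beta> \<Longrightarrow>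
      0 < \<alpha> \<and> \<alpha> < \<mu> \<and> \<beta> + \<alpha> * \<kappa> \<le> \<kappa> * \<mu> \<and> p * \<epsilon> \<le> 1 \<and>
      \<kappa> + 2 * \<beta> * (1 / ((\<mu> - \<alpha>) * (ln \<gamma> / l))) \<le> p * \<epsilon> \<and>
      (\<forall>\<tau> > ln \<gamma> / l + M * \<epsilon>. exp (- \<alpha> * \<tau>) * (\<gamma> + 2 * \<beta> * (\<beta> / (\<mu> - \<alpha>)) + \<beta> * (p * \<epsilon>)) < 1)"
proof -
  define \<tau>0 where "\<tau>0 = ln \<gamma> / l"
  have \<tau>0: "\<tau>0 > 0" using pos by (simp add: \<tau>0_def)
  \<comment> \<open>\<open>C\<close> measures the loss of slow rate,
    \<open>\<alpha> = l - C * \<epsilon>\<close>. The two parts of \<open>p\<close> dominate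
    \<open>\<kappa>\<close> and the damped initial fast part, and \<open>c * \<epsilon>\<close>
    bounds the excess of the jump factor over \<open>\<gamma>\<close>. \<open>M\<close> solves
    \<open>l / 2 * M = c + C * \<tau>0\<close>, so extra dwell time pays for both losses.\<close>
  define C where "C = 2 * \<beta>\<^sup>2 / m"
  define p where "p = 2 * \<beta> / m + 4 * \<beta> / (m * \<tau>0)"
  define c where "c = 4 * \<beta>\<^sup>2 / m + \<beta> * p"
  define M where "M = 2 * (c + C * \<tau>0) / l"
  \<comment> \<open>The three bounds secure, in this order,
    \<open>m / (2 * \<epsilon>) \<le> \<mu> - \<alpha>\<close>, \<open>l / 2 \<le> \<alpha>\<close>
    and \<open>p * \<epsilon> \<le> 1\<close>.\<close>
  define \<epsilon>1 where "\<epsilon>1 = min (min (m / (2 * (\<beta> + l))) (l / (2 * C))) (1 / p)"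
  have p: "p > 0" and C: "C > 0" using pos \<tau>0 by (auto simp: p_def C_def intro!: add_pos_pos)
  have c: "c > 0" using p pos by (auto simp: c_def intro!: add_pos_pos)
  have M: "M > 0" using c C \<tau>0 pos by (auto simp: M_def intro!: add_pos_pos divide_pos_pos)
  have \<epsilon>1: "\<epsilon>1 > 0" using p C pos by (simp add: \<epsilon>1_def)
  show ?thesis
  proof (rule that[OF \<epsilon>1 M p])
    fix \<epsilon> \<mu> \<kappa> \<alpha> :: real
    assume \<epsilon>: "0 < \<epsilon>" "\<epsilon> < \<epsilon>1" and \<mu>: "\<mu> = m / \<epsilon> - \<beta>" and \<kappa>: "\<kappa> = 2 * \<beta> * \<epsilon> / m"
      and \<alpha>: "\<alpha> = l - \<kappa> * \<beta>"
    have e1: "2 * \<epsilon> * (\<beta> + l) < m" and e2: "2 * C * \<epsilon> < l" and e3: "p * \<epsilon> < 1"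
      using \<epsilon>(2) p C pos by (auto simp: \<epsilon>1_def field_simps)
    have \<alpha>C: "\<alpha> = l - C * \<epsilon>" by (simp add: \<alpha> \<kappa> C_def power2_eq_square)
    hence \<alpha>l: "l / 2 \<le> \<alpha>" "\<alpha> \<le> l" "0 < \<alpha>" using e2 C \<epsilon> pos by auto
    have \<kappa>0: "0 \<le> \<kappa>" using \<epsilon> pos by (simp add: \<kappa>)
    have "\<beta> + l \<le> m / (2 * \<epsilon>)" using e1 \<epsilon> by (simp add: field_simps)
    moreover have "m / \<epsilon> = m / (2 * \<epsilon>) + m / (2 * \<epsilon>)" by simp
    ultimately have gap: "m / (2 * \<epsilon>) \<le> \<mu> - \<alpha>" using \<alpha>l by (simp add: \<mu>)
    have gap0: "0 < m / (2 * \<epsilon>)" using pos \<epsilon> by simp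
    have K: "\<beta> / (\<mu> - \<alpha>) \<le> 2 * \<beta> / m * \<epsilon>"
    proof -
      have "\<beta> / (\<mu> - \<alpha>) \<le> \<beta> / (m / (2 * \<epsilon>))" using gap gap0 pos by (intro divide_left_mono mult_pos_pos) auto
      thus ?thesis using \<epsilon> pos by (simp add: field_simps)
    qed
    have \<omega>: "1 / ((\<mu> - \<alpha>) * \<tau>0) \<le> 2 / (m * \<tau>0) * \<epsilon>"
    proof -
      have "1 / ((\<mu> - \<alpha>) * \<tau>0) \<le> 1 / (m / (2 * \<epsilon>) * \<tau>0)"
        using gap gap0 \<tau>0 by (intro divide_left_mono mult_right_mono mult_pos_pos) auto
      thus ?thesis using \<epsilon> pos \<tau>0 by (simp add: field_simps)
    qed
    \<comment> \<open>The factor \<open>2\<close> in \<open>\<kappa>\<close> gives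
      \<open>\<kappa> * \<mu> = 2 * \<beta> - \<kappa> * \<beta>\<close>: one \<open>\<beta>\<close>
      covers the coupling, the remainder covers \<open>\<alpha> * \<kappa>\<close>.\<close>
    have "\<beta> + \<alpha> * \<kappa> \<le> \<beta> + l * \<kappa>" using \<alpha>l \<kappa>0 by (simp add: mult_right_mono)
    also have "l * \<kappa> \<le> \<beta> - \<kappa> * \<beta>"
    proof -
      have "\<kappa> * (\<beta> + l) * m = \<beta> * (2 * \<epsilon> * (\<beta> + l))" using pos by (simp add: \<kappa>)
      also have "\<dots> \<le> \<beta> * m" using e1 pos by (intro mult_left_mono) auto
      finally have "\<kappa> * (\<beta> + l) \<le> \<beta>" using pos by simp
      thus ?thesis by (simp add: algebra_simps)
    qed
    also have "\<beta> + (\<beta> - \<kappa> * \<beta>) = \<kappa> * \<mu>" using \<epsilon> pos by (simp add: \<kappa> \<mu> field_simps)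
    finally have rate: "\<beta> + \<alpha> * \<kappa> \<le> \<kappa> * \<mu>" by simp
    have weight: "\<kappa> + 2 * \<beta> * (1 / ((\<mu> - \<alpha>) * \<tau>0)) \<le> p * \<epsilon>"
    proof -
      have "2 * \<beta> * (1 / ((\<mu> - \<alpha>) * \<tau>0)) \<le> 2 * \<beta> * (2 / (m * \<tau>0) * \<epsilon>)"
        using \<omega> pos by (intro mult_left_mono) auto
      thus ?thesis by (simp add: \<kappa> p_def algebra_simps)
    qed
    have "exp (- \<alpha> * \<tau>) * (\<gamma> + 2 * \<beta> * (\<beta> / (\<mu> - \<alpha>)) + \<beta> * (p * \<epsilon>)) < 1"
      if \<tau>: "\<tau> > \<tau>0 + M * \<epsilon>" for \<tau>
    proof -
      have "2 * \<beta> * (\<beta> / (\<mu> - \<alpha>)) \<le> 2 * \<beta> * (2 * \<beta> / m * \<epsilon>)"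
        using K pos by (intro mult_left_mono) auto
      hence "\<gamma> + 2 * \<beta> * (\<beta> / (\<mu> - \<alpha>)) + \<beta> * (p * \<epsilon>) \<le> \<gamma> + 1 * (c * \<epsilon>)"
        by (simp add: c_def algebra_simps power2_eq_square)
      \<comment> \<open>\<open>\<gamma> > 1\<close> makes the error relative to
        \<open>\<gamma>\<close>, so that it becomes a summand of the exponent.\<close>
      also have "\<dots> \<le> \<gamma> + \<gamma> * (c * \<epsilon>)"
        using pos c \<epsilon> by (intro add_left_mono mult_right_mono) auto
      also have "\<dots> = \<gamma> * (1 + c * \<epsilon>)" by (simp add: algebra_simps)
      also have "\<dots> \<le> \<gamma> * exp (c * \<epsilon>)" using pos by (intro mult_left_mono exp_ge_add_one_self) auto
      also have "\<dots> = exp (ln \<gamma> + c * \<epsilon>)" using pos by (simp add: exp_add)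
      also have "\<dots> < exp (\<alpha> * \<tau>)"
      proof -
        have "l / 2 * (M * \<epsilon>) \<le> \<alpha> * (M * \<epsilon>)" using \<alpha>l M \<epsilon> by (intro mult_right_mono) auto
        moreover have "l / 2 * (M * \<epsilon>) = c * \<epsilon> + C * \<epsilon> * \<tau>0"
          using pos by (simp add: M_def field_simps)
        moreover have "\<alpha> * \<tau>0 = ln \<gamma> - C * \<epsilon> * \<tau>0"
          using pos by (simp add: \<alpha>C \<tau>0_def left_diff_distrib diff_divide_distrib)
        moreover have "\<alpha> * (\<tau>0 + M * \<epsilon>) < \<alpha> * \<tau>" using \<tau> \<alpha>l by (intro mult_strict_left_mono)
        ultimately show ?thesis by (simp add: distrib_left)
      qed
      finally have "exp (- \<alpha> * \<tau>) * (\<gamma> + 2 * \<beta> * (\<beta> / (\<mu> - \<alpha>)) + \<beta> * (p * \<epsilon>))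
          < exp (- \<alpha> * \<tau>) * exp (\<alpha> * \<tau>)" by (rule mult_strict_left_mono) simp
      thus ?thesis by (simp flip: exp_add)
    qed
    thus "0 < \<alpha> \<and> \<alpha> < \<mu> \<and> \<beta> + \<alpha> * \<kappa> \<le> \<kappa> * \<mu> \<and> p * \<epsilon> \<le> 1 \<and>
      \<kappa> + 2 * \<beta> * (1 / ((\<mu> - \<alpha>) * (ln \<gamma> / l))) \<le> p * \<epsilon> \<and>
      (\<forall>\<tau> > ln \<gamma> / l + M * \<epsilon>. exp (- \<alpha> * \<tau>) * (\<gamma> + 2 * \<beta> * (\<beta> / (\<mu> - \<alpha>)) + \<beta> * (p * \<epsilon>)) < 1)"
      using \<alpha>l gap gap0 rate e3 weight unfolding \<tau>0_def[symmetric] by auto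
  qed
qed

text \<open>\<open>E\<close> and \<open>E'\<close> stand for slow and fast decay over a period, and
  \<open>p\<close> for the whole weight of the fast part (\<open>p * \<epsilon>\<close> in the
  application). Since \<open>p \<le> 1\<close>, the contribution of \<open>wf1\<close> counts at
  most twice, and the resulting coefficient \<open>\<kappa> + 2 * \<beta> * \<omega>\<close> of
  \<open>wf0\<close> fits under \<open>p\<close>.\<close>

lemma jump_contraction:
  fixes \<beta> :: real
  assumes flow: "ws1 \<le> E * V0" "wf1 \<le> E' * wf0 + K * E * V0" "E' \<le> E * \<omega>"
    and V0: "V0 = ws0 + \<kappa> * wf0"
    and jump: "ws2 \<le> \<gamma> * ws1 + \<beta> * wf1" "wf2 \<le> \<beta> * ws1 + \<beta> * wf1"
    and G: "G = \<gamma> + 2 * \<beta> * K + \<beta> * p" "G \<ge> 1"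
    and p: "\<kappa> + 2 * \<beta> * \<omega> \<le> p" "0 \<le> p" "p \<le> 1"
    and nn: "0 \<le> \<beta>" "0 \<le> \<gamma>" "0 \<le> K" "0 \<le> \<kappa>" "0 \<le> \<omega>" "0 \<le> E" "0 \<le> ws0" "0 \<le> wf0"
  shows "ws2 + p * wf2 \<le> E * G * (ws0 + p * wf0)"
proof -
  have V: "0 \<le> V0" using nn by (simp add: V0)
  have wf1: "wf1 \<le> E * (\<omega> * wf0 + K * V0)"
    using flow(2) mult_right_mono[OF flow(3) nn(8)] by (simp add: algebra_simps)
  have a: "ws2 \<le> E * (\<gamma> * V0 + \<beta> * (\<omega> * wf0 + K * V0))"
    using jump(1) mult_left_mono[OF flow(1) nn(2)] mult_left_mono[OF wf1 nn(1)]
    by (simp add: algebra_simps)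
  have b: "wf2 \<le> E * (\<beta> * V0 + \<beta> * (\<omega> * wf0 + K * V0))"
    using jump(2) mult_left_mono[OF flow(1) nn(1)] mult_left_mono[OF wf1 nn(1)]
    by (simp add: algebra_simps)
  define U where "U = \<beta> * (\<omega> * wf0 + K * V0)"
  have U: "0 \<le> U" using nn V by (simp add: U_def)
  have "ws2 + p * wf2 \<le> E * (\<gamma> * V0 + U) + p * (E * (\<beta> * V0 + U))"
    using a mult_left_mono[OF b p(2)] unfolding U_def by linarith
  also have "\<dots> = E * (\<gamma> * V0 + U + p * \<beta> * V0 + p * U)" by (simp add: algebra_simps)
  also have "\<dots> \<le> E * (\<gamma> * V0 + U + p * \<beta> * V0 + 1 * U)"
    using U p nn by (intro mult_left_mono add_left_mono mult_right_mono) auto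
  also have "\<dots> = E * (G * V0 + 2 * \<beta> * \<omega> * wf0)" by (simp add: U_def G(1) algebra_simps)
  \<comment> \<open>\<open>G \<ge> 1\<close> lets \<open>G\<close> be factored out of the
    \<open>wf0\<close> term as well.\<close>
  also have "\<dots> \<le> E * (G * V0 + G * (2 * \<beta> * \<omega> * wf0))"
  proof -
    have "0 \<le> 2 * \<beta> * \<omega> * wf0" using nn by simp
    from mult_right_mono[OF G(2) this] show ?thesis using nn by (intro mult_left_mono) auto
  qed
  also have "\<dots> = E * G * (ws0 + (\<kappa> + 2 * \<beta> * \<omega>) * wf0)" by (simp add: V0 algebra_simps)
  also have "\<dots> \<le> E * G * (ws0 + p * wf0)"
    using nn p G by (intro mult_left_mono add_left_mono mult_right_mono) auto
  finally show ?thesis .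
qed

section \<open>From geometric decay along events to asymptotic stability\<close>

lemma event_times_interval:
  assumes "event_times t" "t N \<le> s"
  obtains k where "k \<ge> N" "t k \<le> s" "s < t (Suc k)"
proof -
  have "\<exists>m. s < t m" using assms(1) unfolding event_times_def bdd_above_def by (metis not_le rangeE)
  define m where "m = (LEAST m. s < t m)"
  have m: "s < t m" unfolding m_def using \<open>\<exists>m. s < t m\<close> by (rule LeastI_ex)
  have mono: "strict_mono t" using assms(1) by (simp add: event_times_def)
  hence "N < m" using m assms(2) by (metis le_less_trans strict_mono_less)
  then obtain k where k: "m = Suc k" "N \<le> k" by (cases m) auto
  moreover have "t k \<le> s" using not_less_Least[of k "\<lambda>m. s < t m"] k(1) by (simp add: m_def)
  ultimately show ?thesis using that m by blast
qed

text \<open>As the powers of \<open>q\<close> decrease, the bound for interval \<open>N\<close>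
  persists at all later times. \<open>N = 0\<close> yields Lyapunov stability, large
  \<open>N\<close> attraction.\<close>

lemma geometric_decay_imp_stable:
  fixes sol :: "(real \<Rightarrow> 'a::real_normed_vector) \<Rightarrow> bool"
  assumes t: "event_times t" and q: "0 \<le> q" "q < 1"
    and decay: "\<And>\<phi> k s. sol \<phi> \<Longrightarrow> s \<in> {t k..<t (Suc k)} \<Longrightarrow> norm (\<phi> s) \<le> C * q ^ k * norm (\<phi> 0)"
  shows "globally_asymptotically_stable sol"
proof -
  have t0: "t 0 = 0" using t by (simp add: event_times_def)
  \<comment> \<open>\<open>C\<close> may have any sign; \<open>D\<close> is positive, so
    \<open>\<rho> / D\<close> is a legitimate radius.\<close>
  define D where "D = \<bar>C\<bar> + 1"
  have D: "D > 0" "C \<le> D" by (auto simp: D_def)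
  have *: "norm (\<phi> s) \<le> D * q ^ N * norm (\<phi> 0)" if sol: "sol \<phi>" and s: "t N \<le> s" for \<phi> N s
  proof -
    obtain k where k: "k \<ge> N" "t k \<le> s" "s < t (Suc k)"
      using event_times_interval[OF t s] .
    have "norm (\<phi> s) \<le> C * q ^ k * norm (\<phi> 0)" using decay[OF sol] k by simp
    also have "\<dots> \<le> D * q ^ N * norm (\<phi> 0)"
      using D k q by (intro mult_right_mono mult_mono power_decreasing) auto
    finally show ?thesis .
  qed
  show ?thesis
    unfolding globally_asymptotically_stable_def
  proof (intro conjI allI impI)
    fix \<rho> :: real assume r: "\<rho> > 0"
    show "\<exists>\<delta>>0. \<forall>\<phi>. sol \<phi> \<and> norm (\<phi> 0) < \<delta> \<longrightarrow> (\<forall>t\<ge>0. norm (\<phi> t) < \<rho>)"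
    proof (intro exI[of _ "\<rho> / D"] conjI allI impI)
      fix \<phi> and s :: real assume "sol \<phi> \<and> norm (\<phi> 0) < \<rho> / D" "0 \<le> s"
      thus "norm (\<phi> s) < \<rho>" using *[of \<phi> 0 s] t0 D by (simp add: field_simps)
    qed (use r D in simp)
  next
    fix \<phi> assume sol: "sol \<phi>"
    show "(\<phi> \<longlongrightarrow> 0) at_top"
    proof (rule tendstoI)
      fix e :: real assume e: "e > 0"
      have "(\<lambda>N. D * q ^ N * norm (\<phi> 0)) \<longlonglongrightarrow> D * 0 * norm (\<phi> 0)"
        using q by (intro tendsto_intros LIMSEQ_realpow_zero)
      hence "eventually (\<lambda>N. D * q ^ N * norm (\<phi> 0) < e) sequentially"
        using e by (intro order_tendstoD(2)) auto
      then obtain N where N: "D * q ^ N * norm (\<phi> 0) < e" by (auto simp: eventually_sequentially)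
      show "\<forall>\<^sub>F s in at_top. dist (\<phi> s) 0 < e"
        using eventually_ge_at_top[of "t N"]
        by eventually_elim (use *[OF sol] N in \<open>force intro: le_less_trans\<close>)
    qed
  qed
qed

lemma spectral_norm_le_gamma11:
  "spectral_norm (psd_sqrt (Qs i') ** block11 (reset_matrix S A J i j i')
      ** matrix_inv (psd_sqrt (Qs i))) \<le> gamma11 S A J Qs"
  unfolding gamma11_def by (rule Max_ge) (auto intro!: rev_image_eqI[of "(i, j, i')"])

lemma finite_range_upper_bound:
  fixes f :: "'k \<Rightarrow> 'i::finite \<Rightarrow> real"
  assumes "finite K"
  shows "\<exists>\<beta>\<ge>1. \<forall>k\<in>K. \<forall>i. f k i \<le> \<beta>"
proof (intro exI[of _ "Max (insert 1 (case_prod f ` (K \<times> UNIV)))"] conjI ballI allI)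
  have fin: "finite (insert 1 (case_prod f ` (K \<times> UNIV)))" using assms by simp
  show "1 \<le> Max (insert 1 (case_prod f ` (K \<times> UNIV)))" using fin by (intro Max_ge) auto
  show "f k i \<le> Max (insert 1 (case_prod f ` (K \<times> UNIV)))" if "k \<in> K" for k i
    using fin that by (intro Max_ge) auto
qed

text \<open>The crude bound \<open>exp x \<ge> x\<close> suffices: with \<open>\<mu>\<close> of
  order \<open>1 / \<epsilon>\<close>, the initial fast part is \<open>O(\<epsilon>)\<close>
  relative to the slow decay, given a positive lower bound \<open>\<tau>0\<close> on the
  period.\<close>

lemma exp_decay_le_inverse:
  fixes \<mu> \<alpha> \<tau> \<tau>0 :: real
  assumes "\<alpha> < \<mu>" "0 < \<tau>0" "\<tau>0 \<le> \<tau>"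
  shows "exp (- \<mu> * \<tau>) \<le> exp (- \<alpha> * \<tau>) * (1 / ((\<mu> - \<alpha>) * \<tau>0))"
proof -
  have x: "0 < (\<mu> - \<alpha>) * \<tau>0" "(\<mu> - \<alpha>) * \<tau>0 \<le> (\<mu> - \<alpha>) * \<tau>" using assms by auto
  have "(\<mu> - \<alpha>) * \<tau>0 \<le> exp ((\<mu> - \<alpha>) * \<tau>)"
    using x exp_ge_add_one_self[of "(\<mu> - \<alpha>) * \<tau>"] by linarith
  hence "inverse (exp ((\<mu> - \<alpha>) * \<tau>)) \<le> inverse ((\<mu> - \<alpha>) * \<tau>0)"
    using x(1) by (rule le_imp_inverse_le)
  hence "exp (- \<alpha> * \<tau>) * exp (- ((\<mu> - \<alpha>) * \<tau>)) \<le> exp (- \<alpha> * \<tau>) * (1 / ((\<mu> - \<alpha>) * \<tau>0))"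
    by (intro mult_left_mono) (simp_all add: exp_minus inverse_eq_divide)
  thus ?thesis by (simp add: algebra_simps flip: exp_add)
qed

text \<open>Carries the flow estimates, available only strictly before an event, over to the left
  limit at it.\<close>

lemma left_limit_le:
  fixes f g :: "real \<Rightarrow> real"
  assumes "(f \<longlongrightarrow> F) (at_left b)" "(g \<longlongrightarrow> G) (at_left b)" "a < b"
    and "\<And>s. a \<le> s \<Longrightarrow> s < b \<Longrightarrow> f s \<le> g s"
  shows "F \<le> G"
proof (rule tendsto_le[OF _ assms(2,1)])
  show "\<forall>\<^sub>F s in at_left b. f s \<le> g s"
    unfolding eventually_at_left_field using assms(3,4) by (intro exI[of _ a]) auto
qed simp

subsection \<open>The stability theorem\<close>

theorem theorem8:
  fixes S A :: "'i::finite \<Rightarrow> real^('x::finite + 'z::finite)^('x + 'z)"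
    and J :: "'j::finite \<Rightarrow> real^('x + 'z)^('x + 'z)"
    and Z :: "'i \<Rightarrow> ('x + 'z) set"
    and Qs :: "'i \<Rightarrow> real^'x^'x" and Qf :: "'i \<Rightarrow> real^'z^'z"
    and ls lf :: "'i \<Rightarrow> real"
  assumes "\<And>i. card (Z i) = CARD('z)"
    and "\<And>i. permutation_matrix (S i)"
    and "\<And>i \<epsilon>. \<epsilon> > 0 \<Longrightarrow>
           S i ** scale_matrix (Z i) \<epsilon> ** transpose (S i)
             = block_matrix (mat 1) 0 0 (\<epsilon> *\<^sub>R mat 1)"
    and "\<And>i. invertible (block22 (flow_matrix S A i))"
    and "\<And>i. hurwitz (coef_A0 (flow_matrix S A i))"
    and "\<And>i. hurwitz (block22 (flow_matrix S A i))"
    and "\<And>i. sym_matrix (Qs i) \<and> loewner_le (mat 1) (Qs i)"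
    and "\<And>i. sym_matrix (Qf i) \<and> loewner_le (mat 1) (Qf i)"
    and "\<And>i. ls i > 0" and "\<And>i. lf i > 0"
    and "\<And>i. loewner_le
           (transpose (coef_A0 (flow_matrix S A i)) ** Qs i + Qs i ** coef_A0 (flow_matrix S A i))
           ((- 2 * ls i) *\<^sub>R Qs i)"
    and "\<And>i. loewner_le
           (transpose (block22 (flow_matrix S A i)) ** Qf i + Qf i ** block22 (flow_matrix S A i))
           ((- 2 * lf i) *\<^sub>R Qf i)"
    and "gamma11 S A J Qs > 1"
  shows "\<exists>\<epsilon>1>0. \<exists>\<eta>1 :: real \<Rightarrow> real.
           (\<forall>\<epsilon>\<in>{0<..<\<epsilon>1}. \<eta>1 \<epsilon> \<ge> 0) \<and> order_eps \<epsilon>1 \<eta>1 \<and>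
           (\<forall>\<epsilon>\<in>{0<..<\<epsilon>1}. \<forall>t. event_times t \<longrightarrow>
              (\<exists>\<tau>. \<tau> > ln (gamma11 S A J Qs) / (MIN i. ls i) + \<eta>1 \<epsilon> \<and>
                   (\<forall>k. t (Suc k) - t k \<ge> \<tau>)) \<longrightarrow>
              (\<forall>(\<sigma> :: nat \<Rightarrow> 'i) (\<nu> :: nat \<Rightarrow> 'j).
                 globally_asymptotically_stable (solution_H S A J \<epsilon> t \<sigma> \<nu>)))"
proof -
  note Qs = conjunct1[OF assms(7)] conjunct2[OF assms(7)]
  note Qf = conjunct1[OF assms(8)] conjunct2[OF assms(8)]

  \<comment> \<open>Constants uniform in modes and jumps\<close>
  define M where "M i = flow_matrix S A i" for i
  define R where "R i j i' = reset_matrix S A J i j i'" for i j i'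
  define \<gamma> where "\<gamma> = gamma11 S A J Qs"
  define l where "l = (MIN i. ls i)"
  define m where "m = (MIN i. lf i)"
  have \<gamma>: "\<gamma> > 1" using assms(13) by (simp add: \<gamma>_def)
  have l: "l > 0" "l \<le> ls i" for i using assms(9) by (auto simp: l_def)
  have m: "m > 0" "m \<le> lf i" for i using assms(10) by (auto simp: m_def)
  \<comment> \<open>Indexing into a list lets one maximum bound five families of matrices of
    different shapes.\<close>
  obtain \<beta>1 where \<beta>1: "\<beta>1 \<ge> 1" "\<And>k i. k < 5 \<Longrightarrow>
      [spectral_norm (psd_sqrt (Qs i)), spectral_norm (psd_sqrt (Qf i)),
       spectral_norm (psd_sqrt (Qs i) ** coef_B1 (M i)), spectral_norm (psd_sqrt (Qf i) ** coef_B2 (M i)),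
       spectral_norm (psd_sqrt (Qf i) ** coef_B3 (M i))] ! k \<le> \<beta>1"
    using finite_range_upper_bound[of "{..<5::nat}" "\<lambda>k i.
      [spectral_norm (psd_sqrt (Qs i)), spectral_norm (psd_sqrt (Qf i)),
       spectral_norm (psd_sqrt (Qs i) ** coef_B1 (M i)), spectral_norm (psd_sqrt (Qf i) ** coef_B2 (M i)),
       spectral_norm (psd_sqrt (Qf i) ** coef_B3 (M i))] ! k"] by auto
  obtain \<beta>2 where \<beta>2: "\<beta>2 \<ge> 1" "\<And>k i j i'. k < 3 \<Longrightarrow>
      [spectral_norm (psd_sqrt (Qs i') ** block12 (R i j i')),
       spectral_norm (psd_sqrt (Qf i') ** block21 (R i j i')),
       spectral_norm (psd_sqrt (Qf i') ** block22 (R i j i'))] ! k \<le> \<beta>2"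
    using finite_range_upper_bound[of "{..<3::nat}" "\<lambda>k (i, j, i').
      [spectral_norm (psd_sqrt (Qs i') ** block12 (R i j i')),
       spectral_norm (psd_sqrt (Qf i') ** block21 (R i j i')),
       spectral_norm (psd_sqrt (Qf i') ** block22 (R i j i'))] ! k"] by fastforce
  define \<beta> where "\<beta> = max \<beta>1 \<beta>2"
  have \<beta>: "\<beta> \<ge> 1" using \<beta>1(1) by (simp add: \<beta>_def)
  have flow_bounds: "spectral_norm (psd_sqrt (Qs i)) \<le> \<beta>" "spectral_norm (psd_sqrt (Qf i)) \<le> \<beta>"
    "spectral_norm (psd_sqrt (Qs i) ** coef_B1 (M i)) \<le> \<beta>"
    "spectral_norm (psd_sqrt (Qf i) ** coef_B2 (M i)) \<le> \<beta>"
    "spectral_norm (psd_sqrt (Qf i) ** coef_B3 (M i)) \<le> \<beta>" for i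
    using \<beta>1(2)[of 0 i] \<beta>1(2)[of 1 i] \<beta>1(2)[of 2 i] \<beta>1(2)[of 3 i] \<beta>1(2)[of 4 i]
    by (auto simp: \<beta>_def numeral_eq_Suc)
  have jump_bounds: "spectral_norm (psd_sqrt (Qs i') ** block12 (R i j i')) \<le> \<beta>"
    "spectral_norm (psd_sqrt (Qf i') ** block21 (R i j i')) \<le> \<beta>"
    "spectral_norm (psd_sqrt (Qf i') ** block22 (R i j i')) \<le> \<beta>" for i j i'
    using \<beta>2(2)[of 0 i' i j] \<beta>2(2)[of 1 i' i j] \<beta>2(2)[of 2 i' i j]
    by (auto simp: \<beta>_def numeral_eq_Suc)
  obtain \<epsilon>1 N p where \<epsilon>1: "\<epsilon>1 > 0" "N > 0" "p > 0" and bounds: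
    "\<And>\<epsilon> \<mu> \<kappa> \<alpha>. 0 < \<epsilon> \<Longrightarrow> \<epsilon> < \<epsilon>1 \<Longrightarrow> \<mu> = m / \<epsilon> - \<beta> \<Longrightarrow> \<kappa> = 2 * \<beta> * \<epsilon> / m \<Longrightarrow> \<alpha> = l - \<kappa> * \<beta> \<Longrightarrow>
      0 < \<alpha> \<and> \<alpha> < \<mu> \<and> \<beta> + \<alpha> * \<kappa> \<le> \<kappa> * \<mu> \<and> p * \<epsilon> \<le> 1 \<and>
      \<kappa> + 2 * \<beta> * (1 / ((\<mu> - \<alpha>) * (ln \<gamma> / l))) \<le> p * \<epsilon> \<and>
      (\<forall>\<tau> > ln \<gamma> / l + N * \<epsilon>. exp (- \<alpha> * \<tau>) * (\<gamma> + 2 * \<beta> * (\<beta> / (\<mu> - \<alpha>)) + \<beta> * (p * \<epsilon>)) < 1)"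
    using small_parameter_bounds[OF \<beta> l(1) m(1) \<gamma>] by blast

  \<comment> \<open>Stability for a fixed parameter and fixed switching sequences\<close>
  have stable: "globally_asymptotically_stable (solution_H S A J \<epsilon> t \<sigma> \<nu>)"
    if \<epsilon>: "0 < \<epsilon>" "\<epsilon> < \<epsilon>1" and t: "event_times t"
      and \<tau>: "\<tau> > ln \<gamma> / l + N * \<epsilon>" "\<And>k. t (Suc k) - t k \<ge> \<tau>" for \<epsilon> t \<tau> \<sigma> \<nu>
  proof -
    define \<mu> where "\<mu> = m / \<epsilon> - \<beta>"
    define \<kappa> where "\<kappa> = 2 * \<beta> * \<epsilon> / m"
    define \<alpha> where "\<alpha> = l - \<kappa> * \<beta>"
    define \<tau>0 where "\<tau>0 = ln \<gamma> / l"
    define \<omega> where "\<omega> = 1 / ((\<mu> - \<alpha>) * \<tau>0)"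
    define K where "K = \<beta> / (\<mu> - \<alpha>)"
    define G where "G = \<gamma> + 2 * \<beta> * K + \<beta> * (p * \<epsilon>)"
    define q where "q = exp (- \<alpha> * \<tau>) * G"
    have par: "0 < \<alpha>" "\<alpha> < \<mu>" "\<beta> + \<alpha> * \<kappa> \<le> \<kappa> * \<mu>" "p * \<epsilon> \<le> 1" "\<kappa> + 2 * \<beta> * \<omega> \<le> p * \<epsilon>" "q < 1"
      using bounds[OF \<epsilon> \<mu>_def \<kappa>_def \<alpha>_def] \<tau>(1) by (auto simp: q_def G_def K_def \<omega>_def \<tau>0_def)
    have "0 < N * \<epsilon>" using \<epsilon> \<epsilon>1 by simp
    hence \<tau>0: "0 < \<tau>0" "\<tau>0 \<le> \<tau>" using \<gamma> l(1) \<tau>(1) unfolding \<tau>0_def by (simp, linarith)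
    have nn: "0 \<le> \<beta>" "0 \<le> \<gamma>" "0 \<le> \<kappa>" "0 \<le> K" "0 \<le> \<omega>" "0 < p * \<epsilon>"
      using \<beta> \<gamma> par(1,2) \<tau>0 \<epsilon> \<epsilon>1 m(1) by (auto simp: \<kappa>_def K_def \<omega>_def)
    have G: "G \<ge> 1" using \<gamma> nn by (simp add: G_def add_nonneg_nonneg add_increasing2 less_imp_le)
    have t_less: "t k < t (Suc k)" for k using t by (simp add: event_times_def strict_mono_Suc_iff)
    \<comment> \<open>\<open>2 * \<beta>\<close> compares \<open>L 0\<close> with the initial norm,
      and \<open>1 / (p * \<epsilon>)\<close> undoes the weight of the fast part. Growth of
      \<open>C\<close> as \<open>\<epsilon>\<close> tends to \<open>0\<close> is harmless, since
      stability is asserted for each \<open>\<epsilon>\<close> separately.\<close>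
    define C where "C = (2 + 1 / (p * \<epsilon>) + K) * (2 * \<beta>)"
    have "norm (\<phi> s) \<le> C * q ^ k * norm (\<phi> 0)"
      if sol: "solution_H S A J \<epsilon> t \<sigma> \<nu> \<phi>" and s: "s \<in> {t k..<t (Suc k)}" for \<phi> k s
    proof -
      define x where "x r = fst (\<phi> r)" for r
      define y where "y r = snd (\<phi> r)" for r
      define ws where "ws k r = norm (psd_sqrt (Qs (\<sigma> k)) *v x r)" for k r
      define wf where "wf k r = norm (psd_sqrt (Qf (\<sigma> k)) *v y r)" for k r
      define V where "V k = ws k (t k) + \<kappa> * wf k (t k)" for k
      define L where "L k = ws k (t k) + p * \<epsilon> * wf k (t k)" for k
      have w0: "0 \<le> ws k r" "0 \<le> wf k r" for k r by (auto simp: ws_def wf_def)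
      have ode: "\<exists>x' y'. (x has_vector_derivative x') (at s within {t k..<t (Suc k)}) \<and>
          (y has_vector_derivative y') (at s within {t k..<t (Suc k)}) \<and>
          x' = coef_A0 (M (\<sigma> k)) *v x s + coef_B1 (M (\<sigma> k)) *v y s \<and>
          \<epsilon> *\<^sub>R y' = (\<epsilon> *\<^sub>R coef_B2 (M (\<sigma> k))) *v x s
            + (block22 (M (\<sigma> k)) + \<epsilon> *\<^sub>R coef_B3 (M (\<sigma> k))) *v y s"
        if "s \<in> {t k..<t (Suc k)}" for s k
        using sol that unfolding solution_H_def Let_def M_def x_def y_def by blast
      have flow: "ws k s + \<kappa> * wf k s \<le> exp (- \<alpha> * (s - t k)) * V k"
        "wf k s \<le> exp (- \<mu> * (s - t k)) * wf k (t k) + K * exp (- \<alpha> * (s - t k)) * V k"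
        if s: "t k \<le> s" "s < t (Suc k)" for k s
        unfolding ws_def wf_def V_def K_def
        by (rule flow_estimate[OF Qs Qf assms(11)[folded M_def] l(2) assms(12)[folded M_def] m(2)
              flow_bounds(3-5) \<epsilon>(1) ode nn(1) less_imp_le[OF l(1)] _ nn(3) par(1,2) \<mu>_def \<alpha>_def par(3) s],
            assumption, use par in simp)+
      have step: "L (Suc k) \<le> q * L k" for k
      proof -
        define \<tau>k where "\<tau>k = t (Suc k) - t k"
        obtain xm ym where lim: "(\<phi> \<longlongrightarrow> (xm, ym)) (at_left (t (Suc k)))"
          and jump: "join_vec (x (t (Suc k))) (y (t (Suc k))) =
            R (\<sigma> k) (\<nu> (Suc k)) (\<sigma> (Suc k)) *v join_vec xm ym"
          using sol[unfolded solution_H_def, THEN conjunct2, rule_format, of "Suc k"]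
          by (auto simp: x_def y_def R_def)
        \<comment> \<open>Left limits carry the weights of the old mode, values at the event those
          of the new one; \<open>\<gamma>\<close> already accounts for this change.\<close>
        define ws1 where "ws1 = norm (psd_sqrt (Qs (\<sigma> k)) *v xm)"
        define wf1 where "wf1 = norm (psd_sqrt (Qf (\<sigma> k)) *v ym)"
        have limx: "(x \<longlongrightarrow> xm) (at_left (t (Suc k)))" and limy: "(y \<longlongrightarrow> ym) (at_left (t (Suc k)))"
          using tendsto_fst[OF lim] tendsto_snd[OF lim] by (simp_all add: x_def[abs_def] y_def[abs_def])
        have limws: "(ws k \<longlongrightarrow> ws1) (at_left (t (Suc k)))"
          unfolding ws_def[abs_def] ws1_def
          by (intro tendsto_norm bounded_linear.tendsto[OF matrix_vector_mul_bounded_linear] limx)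
        have limwf: "(wf k \<longlongrightarrow> wf1) (at_left (t (Suc k)))"
          unfolding wf_def[abs_def] wf1_def
          by (intro tendsto_norm bounded_linear.tendsto[OF matrix_vector_mul_bounded_linear] limy)
        have 1: "ws1 + \<kappa> * wf1 \<le> exp (- \<alpha> * \<tau>k) * V k"
          unfolding \<tau>k_def
          by (rule left_limit_le[OF _ _ t_less flow(1)]) (auto intro!: tendsto_intros limws limwf)
        have 2: "wf1 \<le> exp (- \<mu> * \<tau>k) * wf k (t k) + K * exp (- \<alpha> * \<tau>k) * V k"
          unfolding \<tau>k_def
          by (rule left_limit_le[OF _ _ t_less flow(2)]) (auto intro!: tendsto_intros limwf)
        have "0 \<le> wf1" by (simp add: wf1_def)
        hence 3: "ws1 \<le> exp (- \<alpha> * \<tau>k) * V k" using 1 mult_nonneg_nonneg[OF nn(3)] by fastforce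
        have bound: "norm (X *v (N *v v)) \<le> \<beta> * w" if "spectral_norm (X ** N) \<le> \<beta>" "norm v \<le> w"
          for X :: "real^'c^'d" and N :: "real^'e^'c" and v w
        proof -
          have "norm (X *v (N *v v)) \<le> spectral_norm (X ** N) * norm v"
            using norm_matrix_vector_le[of "X ** N" v] by (simp add: matrix_vector_mul_assoc)
          also have "\<dots> \<le> \<beta> * w" using that nn(1) by (intro mult_mono) auto
          finally show ?thesis .
        qed
        have ys: "norm ym \<le> wf1" "norm xm \<le> ws1"
          using norm_psd_sqrt_mult(2)[OF Qs] norm_psd_sqrt_mult(2)[OF Qf] by (auto simp: ws1_def wf1_def)
        have "ws (Suc k) (t (Suc k)) \<le> \<gamma> * ws1 + \<beta> * wf1"
          unfolding ws_def block_mult_join_vec(1)[OF jump] matrix_vector_right_distrib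
        proof (intro order_trans[OF norm_triangle_ineq] add_mono bound jump_bounds ys)
          show "norm (psd_sqrt (Qs (\<sigma> (Suc k))) *v (block11 (R (\<sigma> k) (\<nu> (Suc k)) (\<sigma> (Suc k))) *v xm)) \<le> \<gamma> * ws1"
            unfolding ws1_def \<gamma>_def R_def
            by (intro order_trans[OF weighted_norm_le[OF psd_sqrt_invertible[OF Qs[of "\<sigma> k"]]]] mult_right_mono
                spectral_norm_le_gamma11) simp
        qed
        moreover have "wf (Suc k) (t (Suc k)) \<le> \<beta> * ws1 + \<beta> * wf1"
          unfolding wf_def block_mult_join_vec(2)[OF jump] matrix_vector_right_distrib
          by (intro order_trans[OF norm_triangle_ineq] add_mono bound jump_bounds ys)
        moreover have "exp (- \<mu> * \<tau>k) \<le> exp (- \<alpha> * \<tau>k) * \<omega>"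
          unfolding \<omega>_def using par \<tau>0 \<tau>(2)[of k] by (intro exp_decay_le_inverse) (auto simp: \<tau>k_def)
        ultimately have "L (Suc k) \<le> exp (- \<alpha> * \<tau>k) * G * L k"
          unfolding L_def
          using 2 3 par nn G w0 by (intro jump_contraction[where \<omega> = \<omega>, OF _ _ _ V_def _ _ G_def]) auto
        \<comment> \<open>A period longer than \<open>\<tau>\<close> only improves the factor,
          because \<open>\<alpha> > 0\<close>.\<close>
        also have "\<dots> \<le> q * L k"
          unfolding q_def using \<tau>(2)[of k] par G nn w0
          by (intro mult_right_mono) (auto simp: L_def \<tau>k_def)
        finally show ?thesis .
      qed
      have q0: "0 \<le> q" using G by (simp add: q_def)
      have L: "L k \<le> q ^ k * L 0" for k
      proof (induction k)
        case (Suc k)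
        thus ?case using step[of k] mult_left_mono[OF Suc q0] by (simp add: mult_ac)
      qed simp
      have L0: "0 \<le> L k" for k using w0 nn by (simp add: L_def)
      \<comment> \<open>Dropping this term from the weight condition leaves
        \<open>\<kappa> \<le> p * \<epsilon>\<close>, which compares \<open>V\<close> with
        \<open>L\<close>.\<close>
      have "0 \<le> 2 * \<beta> * \<omega>" using nn by simp
      hence VL: "V k \<le> L k" using par(5) w0 by (simp add: V_def L_def mult_right_mono)
      have V0: "0 \<le> V k" using w0 nn by (simp add: V_def)
      have s: "t k \<le> s" "s < t (Suc k)" using s by auto
      have wsb: "ws k s + \<kappa> * wf k s \<le> L k"
        using flow(1)[OF s] mult_left_le_one_le[OF V0, of "exp (- \<alpha> * (s - t k))"] VL s par by simp
      have wfb: "wf k s \<le> 1 / (p * \<epsilon>) * L k + K * L k"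
      proof -
        have "wf k (t k) \<le> 1 / (p * \<epsilon>) * L k" using nn(6) w0 by (simp add: L_def field_simps)
        moreover have "exp (- \<mu> * (s - t k)) * wf k (t k) \<le> 1 * wf k (t k)"
          using s par w0 by (intro mult_right_mono) auto
        moreover have "K * exp (- \<alpha> * (s - t k)) * V k \<le> K * 1 * L k"
          using s par nn V0 VL by (intro mult_mono) auto
        ultimately show ?thesis using flow(2)[OF s] by simp
      qed
      have "norm (\<phi> s) \<le> norm (x s) + norm (y s)"
        using norm_Pair_le[of "fst (\<phi> s)" "snd (\<phi> s)"] by (simp add: x_def y_def)
      also have "\<dots> \<le> ws k s + wf k s"
        unfolding ws_def wf_def by (intro add_mono norm_psd_sqrt_mult(2) Qs Qf)
      also have "\<dots> \<le> (2 + 1 / (p * \<epsilon>) + K) * L k"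
        using wsb wfb L0[of k] mult_nonneg_nonneg[OF nn(3) w0(2)[of k s]] unfolding distrib_right by linarith
      also have "\<dots> \<le> (2 + 1 / (p * \<epsilon>) + K) * (q ^ k * L 0)"
        using L nn by (intro mult_left_mono) (auto intro!: add_nonneg_nonneg divide_nonneg_pos)
      also have "\<dots> \<le> (2 + 1 / (p * \<epsilon>) + K) * (q ^ k * (2 * \<beta> * norm (\<phi> 0)))"
      proof -
        have "t 0 = 0" using t by (simp add: event_times_def)
        hence "ws 0 (t 0) \<le> \<beta> * norm (\<phi> 0)" "wf 0 (t 0) \<le> \<beta> * norm (\<phi> 0)"
          unfolding ws_def wf_def x_def y_def
          using norm_fst_le[of "fst (\<phi> 0)" "snd (\<phi> 0)"] norm_snd_le[of "snd (\<phi> 0)" "fst (\<phi> 0)"] flow_bounds(1,2) nn(1)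
          by (auto intro!: order_trans[OF norm_matrix_vector_le] mult_mono)
        moreover have "p * \<epsilon> * wf 0 (t 0) \<le> 1 * wf 0 (t 0)" using par w0 by (intro mult_right_mono)
        ultimately have "L 0 \<le> 2 * \<beta> * norm (\<phi> 0)" by (simp add: L_def)
        thus ?thesis using q0 nn
          by (intro mult_left_mono) (auto intro!: add_nonneg_nonneg divide_nonneg_pos)
      qed
      finally show ?thesis unfolding C_def by (simp only: mult_ac)
    qed
    thus ?thesis using t par(6) G by (intro geometric_decay_imp_stable[of t q]) (auto simp: q_def)
  qed
  show ?thesis
  \<comment> \<open>The dwell-time correction is the linear function \<open>N * \<epsilon>\<close>.
    The witness \<open>\<epsilon>1 / 2\<close> below lies strictly inside the interval, as
    \<open>order_eps\<close> demands.\<close>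
  proof (intro exI[of _ \<epsilon>1] conjI exI[of _ "\<lambda>\<epsilon>. N * \<epsilon>"])
    show "order_eps \<epsilon>1 (\<lambda>\<epsilon>. N * \<epsilon>)"
      unfolding order_eps_def using \<epsilon>1 by (intro bexI[of _ "\<epsilon>1 / 2"] exI[of _ N]) auto
  qed (use \<epsilon>1 stable in \<open>auto simp: \<gamma>_def l_def\<close>)
qed

end
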